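(* Let $N\ge2$ and $C_0\ge2$. There exists a constant $M\ge1$ depending only on $N$ and $C_0$ such that the following holds. Let $\Omega$ be an open subset of $\mathbf{R}^N$ and let $K$ be a relatively closed subset of $\Omega$. Assume that: (i) for all $x_0\in K$ and $r>0$ such that $B(x_0,r)\subset\Omega$, $$C_0^{-1}r^{N-1}\le\mathcal{H}^{N-1}(K\cap B(x_0,r))\le C_0r^{N-1};$$ (ii) for all $x_0\in K$ and $r>0$ such that $B(x_0,r)\subset\Omega$, the ball $B(x_0,r)$ meets at least two connected components of $\Omega\setminus K$; (iii) for all $x_0\in K$ and $r>0$ such that $B(x_0,2r)\subset\Omega$ and for all connected components $V$ of $\Omega\setminus K$, the domain $$\bigl(V\cap B(x_0,2r)\bigr)\cup\bigl(B(x_0,2r)\setminus\overline{B}(x_0,r)\bigr)$$ is a John domain with constant $C_0$. Then for all $x_0\in K$, for all $r>0$ such that $B(x_0,2r)\subset\Omega$ and for all topological competitors $F$ of $K$ in $B(x_0,r)$, $$\mathcal{H}^{N-1}(K\setminus F)\le M\,\mathcal{H}^{N-1}(F\setminus K).$$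
   Context: $B(x,r)$ denotes the open ball of center $x$ and radius $r$, $\overline{B}(x,r)$ the closed ball; $\mathcal{H}^{N-1}$ is the $(N-1)$-dimensional Hausdorff measure. A topological competitor of a relatively closed set $K\subset\Omega$ in a ball $B(x_0,r)$ with $\overline{B}(x_0,r)\subset\Omega$ is a relatively closed subset $F\subset\Omega$ such that $F\setminus B(x_0,r)=K\setminus B(x_0,r)$ and such that for all $x,y\in\Omega\setminus(B(x_0,r)\cup K)$, if $x,y$ lie in distinct connected components of $\Omega\setminus K$, then they lie in distinct connected components of $\Omega\setminus F$. John domain: a bounded open set $V\subset\mathbf{R}^N$ is a John domain of center $z_0\in V$ with constant $C\ge1$ if for all $z\in V$ there exists a $C$-Lipschitz path $\gamma:[0,\ell]\to V$, where $\ell=|z-z_0|$, such that $\gamma(0)=z$, $\gamma(\ell)=z_0$ and $\mathrm{dist}(\gamma(t),\mathbf{R}^N\setminus V)\ge C^{-1}t$ for all $t\in[0,\ell]$. It is a John domain with constant $C$ if this holds for some center $z_0\in V$. *)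

theory Defs
  imports "HOL-Analysis.Analysis"
begin

(* d-dimensional Hausdorff (outer) measure for an integer dimension d, normalised so that on a
   d-dimensional Euclidean space it is Lebesgue measure.  Boundedness of the covering sets is
   required because diameter is only meaningful for bounded sets; empty covering sets contribute
   0 also when d = 0 (where 0 ^ 0 = 1 is the right contribution of a singleton). *)

definition hausdorff_premeasure :: "nat \<Rightarrow> real \<Rightarrow> 'a::metric_space set \<Rightarrow> ennreal" where
  "hausdorff_premeasure d \<delta> A =
     (INF U \<in> {U :: nat \<Rightarrow> 'a set. A \<subseteq> (\<Union>i. U i) \<and> (\<forall>i. bounded (U i) \<and> diameter (U i) \<le> \<delta>)}.
        \<Sum>i. if U i = {} then 0
            else ennreal (unit_ball_vol (real d) * (diameter (U i) / 2) ^ d))"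

definition hausdorff_measure :: "nat \<Rightarrow> 'a::metric_space set \<Rightarrow> ennreal" where
  "hausdorff_measure d A = (SUP \<delta> \<in> {0<..}. hausdorff_premeasure d \<delta> A)"

definition john_domain_center :: "real \<Rightarrow> 'a \<Rightarrow> 'a::euclidean_space set \<Rightarrow> bool" where
  "john_domain_center C z0 V \<longleftrightarrow>
     1 \<le> C \<and> bounded V \<and> open V \<and> z0 \<in> V \<and>
     (\<forall>z\<in>V. \<exists>\<gamma> :: real \<Rightarrow> 'a.
        C-lipschitz_on {0..dist z z0} \<gamma> \<and>
        \<gamma> ` {0..dist z z0} \<subseteq> V \<and>
        \<gamma> 0 = z \<and> \<gamma> (dist z z0) = z0 \<and>
        (\<forall>t\<in>{0..dist z z0}. t / C \<le> infdist (\<gamma> t) (- V)))"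

definition john_domain :: "real \<Rightarrow> 'a::euclidean_space set \<Rightarrow> bool" where
  "john_domain C V \<longleftrightarrow> (\<exists>z0\<in>V. john_domain_center C z0 V)"

(* Points outside the ball and K lie in \<Omega> - K and in \<Omega> - F, so both component sets below
   are nonempty and are genuine connected components. *)

definition topological_competitor ::
    "'a::euclidean_space set \<Rightarrow> 'a set \<Rightarrow> 'a \<Rightarrow> real \<Rightarrow> 'a set \<Rightarrow> bool" where
  "topological_competitor \<Omega> K x0 r F \<longleftrightarrow>
     closedin (top_of_set \<Omega>) K \<and> cball x0 r \<subseteq> \<Omega> \<and>
     closedin (top_of_set \<Omega>) F \<and>
     F - ball x0 r = K - ball x0 r \<and>
     (\<forall>x \<in> \<Omega> - (ball x0 r \<union> K). \<forall>y \<in> \<Omega> - (ball x0 r \<union> K).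
        connected_component_set (\<Omega> - K) x \<noteq> connected_component_set (\<Omega> - K) y \<longrightarrow>
        connected_component_set (\<Omega> - F) x \<noteq> connected_component_set (\<Omega> - F) y)"

end

theory Submission
  imports Defs
begin

text \<open>
  Write \<open>N\<close> for the dimension, \<open>H\<close> for the \<open>(N - 1)\<close>-dimensional Hausdorff measure, and let \<open>F\<close> be a
  competitor of \<open>K\<close> in \<open>ball x0 r\<close>.  The heart of the matter is local
  (\<open>thick_ball_near_removed_point\<close>): near every \<open>x \<in> K - F\<close> there is a ball of some radius \<open>\<rho>\<close>, at
  distance at most a constant times \<open>\<rho>\<close> from \<open>x\<close>, in which \<open>F - K\<close> has measure at least a constant
  times \<open>\<rho> ^ (N - 1)\<close>.  Vitali's covering lemma then selects countably many such places with
  disjoint balls, and the upper bound for \<open>H\<close> on \<open>K\<close> shows that the enlarged balls, which cover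
  \<open>K - F\<close>, carry no more of \<open>K\<close> than a constant times what the small ones carry of \<open>F - K\<close>.

  To find the ball, note that two components \<open>V\<close> and \<open>W\<close> of \<open>\<Omega> - K\<close> come arbitrarily close to \<open>x\<close>,
  whereas \<open>F\<close> stays away from \<open>x\<close>.  If points of \<open>V\<close> and of \<open>W\<close> near \<open>x\<close> could both be joined, in
  \<open>\<Omega> - F\<close>, to points of \<open>V\<close> and \<open>W\<close> outside \<open>ball x0 r\<close>, these two exterior points would lie in one
  component of \<open>\<Omega> - F\<close> and in different components of \<open>\<Omega> - K\<close>, which a competitor forbids.  So
  for one of the two components the set \<open>F\<close> blocks every way out.  The John condition provides a way
  out that widens as it proceeds: a curve along which a ball fits into the domain whose radius is at
  least a constant times the distance already travelled.  If \<open>F\<close> had small measure, relative to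
  \<open>\<rho> ^ (N - 1)\<close>, in each of these balls, it could not block the way
  (\<open>john_domain_escape\<close>).

  The last claim rests on a quantitative statement in a single ball
  (\<open>ball_minus_thin_cover_mostly_connected\<close>) that replaces the relative isoperimetric inequality:
  a set of small \<open>(N - 1)\<close>-dimensional measure is met by only a small proportion of the segments
  between two points of the ball, so all but a small proportion of the points of the ball lie in one
  component of the complement.  Nearby balls share most of their volume, so these large pieces
  overlap, and the component containing them is locally constant along a connected family of balls
  (\<open>connected_family_of_thin_balls\<close>).  No loss accumulates however many scales the family passes
  through, and this is why the constant does not depend on how close to \<open>x\<close> the curve starts.
\<close>

section \<open>Hausdorff measure as an outer measure\<close>

lemma hausdorff_premeasure_mono:
  "A \<subseteq> B \<Longrightarrow> hausdorff_premeasure d \<delta> A \<le> hausdorff_premeasure d \<delta> B"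
  unfolding hausdorff_premeasure_def by (intro INF_superset_mono) auto

lemma hausdorff_premeasure_antimono:
  "\<delta> \<le> \<epsilon> \<Longrightarrow> hausdorff_premeasure d \<epsilon> A \<le> hausdorff_premeasure d \<delta> A"
  unfolding hausdorff_premeasure_def by (intro INF_superset_mono) (auto intro: order_trans)

lemma hausdorff_measure_mono:
  "A \<subseteq> B \<Longrightarrow> hausdorff_measure d A \<le> hausdorff_measure d B"
  unfolding hausdorff_measure_def by (intro SUP_mono) (auto intro: hausdorff_premeasure_mono)

lemma hausdorff_premeasure_empty: "0 < \<delta> \<Longrightarrow> hausdorff_premeasure d \<delta> {} = 0"
proof -
  assume "0 < \<delta>"
  then have "hausdorff_premeasure d \<delta> ({} :: 'a set)
      \<le> (\<Sum>i::nat. if ({} :: 'a set) = {} then 0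
           else ennreal (unit_ball_vol (real d) * (diameter ({} :: 'a set) / 2) ^ d))"
    unfolding hausdorff_premeasure_def by (intro INF_lower2[where i = "\<lambda>_. {}"]) auto
  then show ?thesis by simp
qed

lemma hausdorff_measure_empty: "hausdorff_measure d {} = 0"
  by (simp add: hausdorff_measure_def hausdorff_premeasure_empty)

lemma hausdorff_premeasure_countably_subadditive:
  "hausdorff_premeasure d \<delta> (\<Union>i. A i) \<le> (\<Sum>i. hausdorff_premeasure d \<delta> (A i))"
proof (rule ennreal_le_epsilon)
  fix e :: real
  assume fin: "(\<Sum>i. hausdorff_premeasure d \<delta> (A i)) < top" and e: "0 < e"
  define w :: "'a set \<Rightarrow> ennreal" where "w = (\<lambda>U. if U = {} then 0
      else ennreal (unit_ball_vol (real d) * (diameter U / 2) ^ d))"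
  define cov where "cov = (\<lambda>A. {U :: nat \<Rightarrow> 'a set. A \<subseteq> (\<Union>i. U i) \<and>
      (\<forall>i. bounded (U i) \<and> diameter (U i) \<le> \<delta>)})"
  have pre: "hausdorff_premeasure d \<delta> A = (INF U\<in>cov A. \<Sum>i. w (U i))" for A
    unfolding hausdorff_premeasure_def w_def cov_def ..
  have "\<exists>U\<in>cov (A i). (\<Sum>n. w (U n))
      < hausdorff_premeasure d \<delta> (A i) + ennreal (e * (1/2) ^ Suc i)" for i
  proof -
    have "hausdorff_premeasure d \<delta> (A i) < top"
      using fin by (rule ennreal_suminf_lessD)
    then have "hausdorff_premeasure d \<delta> (A i)
        < hausdorff_premeasure d \<delta> (A i) + ennreal (e * (1/2) ^ Suc i)"
      using e by simp
    then show ?thesis by (simp add: pre INF_less_iff)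
  qed
  then have "\<forall>i. \<exists>U. U \<in> cov (A i) \<and> (\<Sum>n. w (U n))
      \<le> hausdorff_premeasure d \<delta> (A i) + ennreal (e * (1/2) ^ Suc i)"
    by (meson less_imp_le)
  then obtain U where U: "\<And>i. U i \<in> cov (A i)"
      and wU: "\<And>i. (\<Sum>n. w (U i n)) \<le> hausdorff_premeasure d \<delta> (A i) + ennreal (e * (1/2) ^ Suc i)"
    by (auto dest!: choice)
  define T where "T = (\<lambda>k. case prod_decode k of (i, n) \<Rightarrow> U i n)"
  have "T \<in> cov (\<Union>i. A i)"
  proof -
    have "(\<Union>i. A i) \<subseteq> (\<Union>k. T k)"
    proof
      fix x assume "x \<in> (\<Union>i. A i)"
      then obtain i where "x \<in> A i" by blast
      then have "x \<in> (\<Union>n. U i n)" using U[of i] by (auto simp: cov_def)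
      then obtain n where "x \<in> U i n" by blast
      then have "x \<in> T (prod_encode (i, n))" by (simp add: T_def)
      then show "x \<in> (\<Union>k. T k)" by blast
    qed
    then show ?thesis using U by (auto simp: cov_def T_def split: prod.split)
  qed
  then have "hausdorff_premeasure d \<delta> (\<Union>i. A i) \<le> (\<Sum>k. w (T k))"
    unfolding pre by (rule INF_lower)
  also have "\<dots> = (\<Sum>k. (\<lambda>(i, n). w (U i n)) (prod_decode k))"
    by (intro suminf_cong) (auto simp: T_def split: prod.split)
  also have "\<dots> = (\<Sum>i. \<Sum>n. w (U i n))"
    by (rule suminf_ennreal_2dimen) simp
  also have "\<dots> \<le> (\<Sum>i. hausdorff_premeasure d \<delta> (A i) + ennreal (e * (1/2) ^ Suc i))"
    by (intro suminf_le wU) auto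
  also have "\<dots> = (\<Sum>i. hausdorff_premeasure d \<delta> (A i)) + (\<Sum>i. ennreal (e * (1/2) ^ Suc i))"
    by (rule suminf_add[symmetric]) auto
  also have "(\<Sum>i. ennreal (e * (1/2) ^ Suc i)) = ennreal e"
    using e sums_mult[OF power_half_series, of e]
    by (subst suminf_ennreal_eq[where x = e]) auto
  finally show "hausdorff_premeasure d \<delta> (\<Union>i. A i)
      \<le> (\<Sum>i. hausdorff_premeasure d \<delta> (A i)) + ennreal e" .
qed

lemma hausdorff_measure_countably_subadditive:
  "hausdorff_measure d (\<Union>i. A i) \<le> (\<Sum>i. hausdorff_measure d (A i))"
  unfolding hausdorff_measure_def[of d "\<Union>i. A i"]
proof (rule SUP_least)
  fix \<delta> :: real assume "\<delta> \<in> {0<..}"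
  then have "hausdorff_premeasure d \<delta> (A i) \<le> hausdorff_measure d (A i)" for i
    unfolding hausdorff_measure_def by (rule SUP_upper)
  then have "(\<Sum>i. hausdorff_premeasure d \<delta> (A i)) \<le> (\<Sum>i. hausdorff_measure d (A i))"
    by (intro suminf_le) auto
  with hausdorff_premeasure_countably_subadditive[of d \<delta> A]
  show "hausdorff_premeasure d \<delta> (\<Union>i. A i) \<le> (\<Sum>i. hausdorff_measure d (A i))"
    by (rule order_trans)
qed

text \<open>
  Countable subadditivity over an arbitrary countable index set.  Bounding the finite partial sums
  lets it be combined directly with the finite superadditivity below, which is what a covering
  argument with disjoint balls needs.
\<close>

lemma hausdorff_measure_le_if_finite_sums_le:
  assumes C: "countable C" and A: "A \<subseteq> (\<Union>i\<in>C. U i)"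
    and fin: "\<And>I. finite I \<Longrightarrow> I \<subseteq> C \<Longrightarrow> (\<Sum>i\<in>I. hausdorff_measure d (A \<inter> U i)) \<le> b"
  shows "hausdorff_measure d A \<le> b"
proof -
  define T where "T = (\<lambda>n. \<Union>i\<in>{i\<in>C. to_nat_on C i = n}. A \<inter> U i)"
  have T: "T (to_nat_on C i) = A \<inter> U i" if "i \<in> C" for i
    using that C by (auto simp: T_def inj_on_eq_iff[OF inj_on_to_nat_on[OF C]])
  have T0: "T n = {}" if "n \<notin> to_nat_on C ` C" for n
    using that by (auto simp: T_def)
  have "hausdorff_measure d A \<le> hausdorff_measure d (\<Union>n. T n)"
  proof (rule hausdorff_measure_mono, rule subsetI)
    fix x assume "x \<in> A"
    moreover obtain i where "i \<in> C" "x \<in> U i" using A \<open>x \<in> A\<close> by blast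
    ultimately have "x \<in> T (to_nat_on C i)" using T by simp
    then show "x \<in> (\<Union>n. T n)" by blast
  qed
  also have "\<dots> \<le> (\<Sum>n. hausdorff_measure d (T n))"
    by (rule hausdorff_measure_countably_subadditive)
  also have "\<dots> = (SUP m. \<Sum>n<m. hausdorff_measure d (T n))"
    by (rule suminf_eq_SUP)
  also have "\<dots> \<le> b"
  proof (rule SUP_least)
    fix m :: nat
    define I where "I = {i\<in>C. to_nat_on C i < m}"
    have inj: "inj_on (to_nat_on C) I"
      using inj_on_to_nat_on[OF C] by (rule inj_on_subset) (auto simp: I_def)
    have "to_nat_on C ` I \<subseteq> {..<m}" by (auto simp: I_def)
    then have finI: "finite I"
      using inj by (metis finite_lessThan finite_subset finite_imageD)
    have "(\<Sum>n<m. hausdorff_measure d (T n)) = (\<Sum>n\<in>to_nat_on C ` I. hausdorff_measure d (T n))"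
    proof (rule sum.mono_neutral_right)
      show "\<forall>n\<in>{..<m} - to_nat_on C ` I. hausdorff_measure d (T n) = 0"
      proof
        fix n assume "n \<in> {..<m} - to_nat_on C ` I"
        then have "n \<notin> to_nat_on C ` C" by (auto simp: I_def)
        then show "hausdorff_measure d (T n) = 0" by (simp add: T0 hausdorff_measure_empty)
      qed
    qed (auto simp: I_def)
    also have "\<dots> = (\<Sum>i\<in>I. hausdorff_measure d (T (to_nat_on C i)))"
      using inj by (simp add: sum.reindex)
    also have "\<dots> = (\<Sum>i\<in>I. hausdorff_measure d (A \<inter> U i))"
      by (intro sum.cong) (auto simp: T I_def)
    also have "\<dots> \<le> b" using finI by (intro fin) (auto simp: I_def)
    finally show "(\<Sum>n<m. hausdorff_measure d (T n)) \<le> b" .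
  qed
  finally show ?thesis .
qed

text \<open>
  A covering set whose diameter is smaller than the distance between \<open>A\<close> and \<open>B\<close> meets at most one
  of them, so a cover of the union splits into a cover of each.
\<close>

lemma hausdorff_premeasure_superadditive:
  assumes "\<And>x y. x \<in> A \<Longrightarrow> y \<in> B \<Longrightarrow> e \<le> dist x y" and "0 < \<delta>" "\<delta> < e"
  shows "hausdorff_premeasure d \<delta> A + hausdorff_premeasure d \<delta> B \<le> hausdorff_premeasure d \<delta> (A \<union> B)"
  unfolding hausdorff_premeasure_def[of d \<delta> "A \<union> B"]
proof (rule INF_greatest)
  fix U assume "U \<in> {U :: nat \<Rightarrow> 'a set. A \<union> B \<subseteq> (\<Union>i. U i) \<and> (\<forall>i. bounded (U i) \<and> diameter (U i) \<le> \<delta>)}"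
  then have cov: "A \<union> B \<subseteq> (\<Union>i. U i)" and U: "\<And>i. bounded (U i)" "\<And>i. diameter (U i) \<le> \<delta>"
    by auto
  define w :: "'a set \<Rightarrow> ennreal" where "w = (\<lambda>U. if U = {} then 0
      else ennreal (unit_ball_vol (real d) * (diameter U / 2) ^ d))"
  define P where "P = (\<lambda>A i. if U i \<inter> A = {} then {} else U i)"
  have P: "hausdorff_premeasure d \<delta> X \<le> (\<Sum>i. w (P X i))" if X: "X \<subseteq> A \<union> B" for X
  proof -
    have "X \<subseteq> (\<Union>i. P X i)" 
    proof
      fix x assume "x \<in> X"
      with X cov have "x \<in> (\<Union>i. U i)" by blast
      then obtain i where "x \<in> U i" by blast
      with \<open>x \<in> X\<close> have "x \<in> P X i" by (auto simp: P_def)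
      then show "x \<in> (\<Union>i. P X i)" by blast
    qed
    then show ?thesis unfolding hausdorff_premeasure_def w_def
      using U \<open>0 < \<delta>\<close> by (intro INF_lower) (auto simp: P_def)
  qed
  have disj: "U i \<inter> A = {} \<or> U i \<inter> B = {}" for i
  proof (rule ccontr)
    assume "\<not> ?thesis"
    then obtain x y where "x \<in> U i" "x \<in> A" "y \<in> U i" "y \<in> B" by blast
    then have "e \<le> dist x y" "dist x y \<le> diameter (U i)"
      using assms(1) U(1) diameter_bounded_bound by blast+
    with U(2)[of i] \<open>\<delta> < e\<close> show False by linarith
  qed
  have "hausdorff_premeasure d \<delta> A + hausdorff_premeasure d \<delta> B \<le> (\<Sum>i. w (P A i)) + (\<Sum>i. w (P B i))"
    by (intro add_mono P) auto
  also have "\<dots> = (\<Sum>i. w (P A i) + w (P B i))"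
    by (rule suminf_add) auto
  also have "\<dots> \<le> (\<Sum>i. w (U i))"
  proof (intro suminf_le)
    fix i show "w (P A i) + w (P B i) \<le> w (U i)"
      using disj[of i] by (auto simp: P_def) (auto simp: w_def)
  qed auto
  finally show "hausdorff_premeasure d \<delta> A + hausdorff_premeasure d \<delta> B
      \<le> (\<Sum>i. if U i = {} then 0 else ennreal (unit_ball_vol (real d) * (diameter (U i) / 2) ^ d))"
    by (simp add: w_def)
qed

lemma hausdorff_measure_superadditive:
  assumes sep: "\<And>x y. x \<in> A \<Longrightarrow> y \<in> B \<Longrightarrow> e \<le> dist x y" and "0 < e"
  shows "hausdorff_measure d A + hausdorff_measure d B \<le> hausdorff_measure d (A \<union> B)"
proof -
  have "hausdorff_measure d A + hausdorff_measure d B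
      = (SUP \<delta>\<in>{0<..}. hausdorff_premeasure d \<delta> A + hausdorff_premeasure d \<delta> B)"
    unfolding hausdorff_measure_def
  proof (rule SUP_add_directed_ennreal[symmetric])
    fix i j :: real assume "i \<in> {0<..}" "j \<in> {0<..}"
    then show "\<exists>k\<in>{0<..}. hausdorff_premeasure d i A + hausdorff_premeasure d j B
        \<le> hausdorff_premeasure d k A + hausdorff_premeasure d k B"
      by (intro bexI[of _ "min i j"] add_mono hausdorff_premeasure_antimono) auto
  qed
  also have "\<dots> \<le> hausdorff_measure d (A \<union> B)"
  proof (rule SUP_least)
    fix \<delta> :: real assume "\<delta> \<in> {0<..}"
    define \<epsilon> where "\<epsilon> = min \<delta> (e / 2)"
    have \<epsilon>: "0 < \<epsilon>" "\<epsilon> \<le> \<delta>" "\<epsilon> < e" using \<open>\<delta> \<in> {0<..}\<close> \<open>0 < e\<close> by (auto simp: \<epsilon>_def)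
    have "hausdorff_premeasure d \<delta> A + hausdorff_premeasure d \<delta> B
        \<le> hausdorff_premeasure d \<epsilon> A + hausdorff_premeasure d \<epsilon> B"
      using \<epsilon> by (intro add_mono hausdorff_premeasure_antimono)
    also have "\<dots> \<le> hausdorff_premeasure d \<epsilon> (A \<union> B)"
      using sep \<epsilon>(1,3) by (rule hausdorff_premeasure_superadditive)
    also have "\<dots> \<le> hausdorff_measure d (A \<union> B)"
      unfolding hausdorff_measure_def using \<epsilon>(1) by (intro SUP_upper) auto
    finally show "hausdorff_premeasure d \<delta> A + hausdorff_premeasure d \<delta> B \<le> hausdorff_measure d (A \<union> B)" .
  qed
  finally show ?thesis .
qed

text \<open>
  Disjoint compact sets have positive distance, so superadditivity on separated sets applies.
\<close>

lemma sum_hausdorff_measure_disjoint_compacts_le: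
  fixes B :: "'i \<Rightarrow> 'a::heine_borel set"
  assumes "finite I" and "\<And>i. i \<in> I \<Longrightarrow> compact (B i)"
    and "pairwise (\<lambda>i j. disjnt (B i) (B j)) I"
  shows "(\<Sum>i\<in>I. hausdorff_measure d (A \<inter> B i)) \<le> hausdorff_measure d (A \<inter> (\<Union>i\<in>I. B i))"
  using assms
proof (induction I)
  case empty
  then show ?case by (simp add: hausdorff_measure_empty)
next
  case (insert i I)
  have "compact (\<Union>j\<in>I. B j)" using insert by (intro compact_UN) auto
  moreover have "B i \<inter> (\<Union>j\<in>I. B j) = {}"
    using insert.prems insert.hyps unfolding pairwise_insert disjnt_def by blast
  ultimately obtain e where e: "0 < e" "\<And>x y. x \<in> B i \<Longrightarrow> y \<in> (\<Union>j\<in>I. B j) \<Longrightarrow> e \<le> dist x y"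
    using separate_compact_closed[OF insert.prems(1)[OF insertI1] compact_imp_closed]
    by (metis (no_types, lifting))
  have "(\<Sum>j\<in>insert i I. hausdorff_measure d (A \<inter> B j))
      = hausdorff_measure d (A \<inter> B i) + (\<Sum>j\<in>I. hausdorff_measure d (A \<inter> B j))"
    using insert by simp
  also have "\<dots> \<le> hausdorff_measure d (A \<inter> B i) + hausdorff_measure d (A \<inter> (\<Union>j\<in>I. B j))"
    using insert by (intro add_left_mono insert.IH) (auto simp: pairwise_insert)
  also have "\<dots> \<le> hausdorff_measure d (A \<inter> B i \<union> A \<inter> (\<Union>j\<in>I. B j))"
    using e by (intro hausdorff_measure_superadditive[of _ _ e]) auto
  also have "A \<inter> B i \<union> A \<inter> (\<Union>j\<in>I. B j) = A \<inter> (\<Union>j\<in>insert i I. B j)"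
    by auto
  finally show ?case .
qed

text \<open>
  The covering sets of the definition may have diameter zero, whereas balls that are to be
  discretised need a positive radius.  The slack \<open>\<tau>\<close> pays for enlarging them.
\<close>

lemma hausdorff_small_imp_ball_cover:
  fixes A :: "'a::metric_space set"
  assumes small: "hausdorff_measure d A < ennreal b" and "0 < \<tau>" and "0 < d"
  obtains u :: "nat \<Rightarrow> 'a" and s where "\<And>i. 0 < s i" "A \<subseteq> (\<Union>i. cball (u i) (s i))"
    "(\<Sum>i. ennreal (s i ^ d)) \<le> ennreal (2 ^ d * b / unit_ball_vol (real d) + \<tau>)"
proof -
  define \<omega> where "\<omega> = unit_ball_vol (real d)"
  have \<omega>: "0 < \<omega>" by (simp add: \<omega>_def)
  have b: "0 < b" using small by (metis ennreal_neg linorder_not_le not_less_zero)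
  have "hausdorff_premeasure d 1 A \<le> hausdorff_measure d A"
    unfolding hausdorff_measure_def by (intro SUP_upper) auto
  then have "hausdorff_premeasure d 1 A < ennreal b" using small by (rule le_less_trans)
  then obtain U where cov: "A \<subseteq> (\<Union>i. U i)" and bdd: "\<And>i. bounded (U i)"
    and sum: "(\<Sum>i. if U i = {} then 0 else ennreal (\<omega> * (diameter (U i) / 2) ^ d)) < ennreal b"
    unfolding hausdorff_premeasure_def INF_less_iff \<omega>_def[symmetric]
    by (elim bexE CollectE conjE) (rule that, auto)
  \<comment> \<open>with a slack of at most 1, the minimal radii imposed below dominate their own powers, so no roots occur\<close>
  define \<sigma> where "\<sigma> = min \<tau> 1"
  have \<sigma>: "0 < \<sigma>" "\<sigma> \<le> \<tau>" "\<sigma> \<le> 1" using \<open>0 < \<tau>\<close> by (auto simp: \<sigma>_def)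
  define u where "u = (\<lambda>i. SOME x. x \<in> U i)"
  define s where "s = (\<lambda>i. max (diameter (U i)) (\<sigma> * (1/2) ^ Suc i))"
  have s: "0 < s i" for i using \<sigma> by (auto simp: s_def less_max_iff_disj)
  have "U i \<subseteq> cball (u i) (s i)" for i
  proof
    fix x assume x: "x \<in> U i"
    then have "u i \<in> U i" unfolding u_def by (rule someI)
    then have "dist (u i) x \<le> diameter (U i)" using x by (rule diameter_bounded_bound[OF bdd])
    then show "x \<in> cball (u i) (s i)" by (simp add: s_def)
  qed
  then have "(\<Union>i. U i) \<subseteq> (\<Union>i. cball (u i) (s i))" by (rule UN_mono[OF subset_refl])
  with cov have cover: "A \<subseteq> (\<Union>i. cball (u i) (s i))" by (rule order_trans)
  let ?w = "\<lambda>i. if U i = {} then 0 else ennreal (\<omega> * (diameter (U i) / 2) ^ d)"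
  have "ennreal (s i ^ d) \<le> ennreal (2 ^ d / \<omega>) * ?w i + ennreal (\<sigma> * (1/2) ^ Suc i)" for i
  proof (cases "diameter (U i) \<le> \<sigma> * (1/2) ^ Suc i")
    case True
    have "\<sigma> * (1/2) ^ Suc i \<le> 1"
      using \<sigma> by (intro mult_le_one power_le_one) auto
    then have "s i ^ d \<le> s i ^ 1"
      using True \<open>0 < d\<close> s[of i] by (intro power_decreasing) (auto simp: s_def)
    then have "s i ^ d \<le> \<sigma> * (1/2) ^ Suc i" using True by (simp add: s_def)
    then have "ennreal (s i ^ d) \<le> ennreal (\<sigma> * (1/2) ^ Suc i)" by (rule ennreal_leI)
    then show ?thesis by (simp add: add_increasing)
  next
    case False
    have "0 < \<sigma> * (1/2) ^ Suc i" using \<sigma>(1) by (intro mult_pos_pos) auto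
    with False have "0 < diameter (U i)" by linarith
    then have "U i \<noteq> {}" by auto
    then have "ennreal (2 ^ d / \<omega>) * ?w i = ennreal (2 ^ d / \<omega> * (\<omega> * (diameter (U i) / 2) ^ d))"
      using \<omega> \<open>0 < diameter (U i)\<close> by (subst ennreal_mult) (auto simp: \<open>U i \<noteq> {}\<close>)
    also have "2 ^ d / \<omega> * (\<omega> * (diameter (U i) / 2) ^ d) = s i ^ d"
      using False \<omega> by (simp add: s_def power_divide)
    finally show ?thesis by simp
  qed
  then have "(\<Sum>i. ennreal (s i ^ d)) \<le> (\<Sum>i. ennreal (2 ^ d / \<omega>) * ?w i + ennreal (\<sigma> * (1/2) ^ Suc i))"
    by (intro suminf_le) auto
  also have "\<dots> = (\<Sum>i. ennreal (2 ^ d / \<omega>) * ?w i) + (\<Sum>i. ennreal (\<sigma> * (1/2) ^ Suc i))"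
    by (rule suminf_add[symmetric]) auto
  also have "(\<Sum>i. ennreal (\<sigma> * (1/2) ^ Suc i)) = ennreal \<sigma>"
    using \<sigma> sums_mult[OF power_half_series, of \<sigma>]
    by (subst suminf_ennreal_eq[where x = \<sigma>]) auto
  also have "(\<Sum>i. ennreal (2 ^ d / \<omega>) * ?w i) = ennreal (2 ^ d / \<omega>) * (\<Sum>i. ?w i)"
    by (rule ennreal_suminf_cmult)
  also have "\<dots> + ennreal \<sigma> \<le> ennreal (2 ^ d / \<omega>) * ennreal b + ennreal \<tau>"
    using sum \<sigma> by (intro add_mono mult_left_mono ennreal_leI) auto
  also have "\<dots> = ennreal (2 ^ d * b / \<omega> + \<tau>)"
    using \<omega> b \<open>0 < \<tau>\<close> by (simp add: ennreal_plus flip: ennreal_mult)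
  finally show ?thesis using that s cover unfolding \<omega>_def by blast
qed

section \<open>Sets of small Hausdorff measure do not separate balls\<close>

text \<open>
  One of the weights \<open>t\<close> and \<open>1 - t\<close> is at least one half.  Fixing the endpoint with the other
  weight, the remaining endpoint is confined to a ball of radius at most \<open>2 * s\<close>.
\<close>

lemma emeasure_pairs_combination_near_point:
  fixes c u :: "'a::euclidean_space" and s t \<rho> :: real
  assumes s: "0 < s" and t: "0 \<le> t" "t \<le> 1"
  defines "S \<equiv> {(p, q). p \<in> ball c \<rho> \<and> q \<in> ball c \<rho> \<and> dist ((1 - t) *\<^sub>R p + t *\<^sub>R q) u \<le> s}"
  shows "S \<in> sets (lborel \<Otimes>\<^sub>M lborel)"
    and "emeasure (lborel \<Otimes>\<^sub>M lborel) S
           \<le> ennreal (unit_ball_vol DIM('a) * (2 * s) ^ DIM('a)) * emeasure lborel (ball c \<rho>)"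
proof -
  have "S = (ball c \<rho> \<times> ball c \<rho>) \<inter> (\<lambda>z. dist ((1 - t) *\<^sub>R fst z + t *\<^sub>R snd z) u) -` {..s}"
    by (auto simp: S_def)
  moreover have "closed ((\<lambda>z :: 'a \<times> 'a. dist ((1 - t) *\<^sub>R fst z + t *\<^sub>R snd z) u) -` {..s})"
    by (intro closed_vimage continuous_intros closed_atMost)
  moreover have "open (ball c \<rho> \<times> ball c \<rho>)" by (intro open_Times) auto
  ultimately have "S \<in> sets borel" by auto
  then show meas: "S \<in> sets (lborel \<Otimes>\<^sub>M lborel)" unfolding lborel_prod by simp
  let ?b = "ennreal (unit_ball_vol DIM('a) * (2 * s) ^ DIM('a))"
  have near: "q \<in> cball ((1 / \<tau>) *\<^sub>R (u - (1 - \<tau>) *\<^sub>R p)) (2 * s)"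
    if "dist ((1 - \<tau>) *\<^sub>R p + \<tau> *\<^sub>R q) u \<le> s" "1/2 \<le> \<tau>" for p q and \<tau> :: real
  proof -
    have "q - (1 / \<tau>) *\<^sub>R (u - (1 - \<tau>) *\<^sub>R p) = (1 / \<tau>) *\<^sub>R ((1 - \<tau>) *\<^sub>R p + \<tau> *\<^sub>R q - u)"
      using that(2) by (simp add: algebra_simps)
    then have "dist ((1 / \<tau>) *\<^sub>R (u - (1 - \<tau>) *\<^sub>R p)) q = (1 / \<tau>) * dist ((1 - \<tau>) *\<^sub>R p + \<tau> *\<^sub>R q) u"
      using that(2) by (simp add: dist_norm norm_minus_commute[of _ q])
    also have "\<dots> \<le> 2 * s"
      using that by (intro mult_mono) (auto simp: field_simps)
    finally show ?thesis by simp
  qed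
  have small: "emeasure lborel A \<le> ?b" if "A \<subseteq> cball v (2 * s)" for A and v :: 'a
  proof -
    have "emeasure lborel A \<le> emeasure lborel (cball v (2 * s))"
      using that by (intro emeasure_mono) auto
    then show ?thesis using s by (simp add: emeasure_cball)
  qed
  have bound: "(\<integral>\<^sup>+p. indicator (ball c \<rho>) p * ?b \<partial>lborel) = ?b * emeasure lborel (ball c \<rho>)"
    by (subst nn_integral_multc) (auto simp: mult.commute intro!: borel_measurable_indicator)
  show "emeasure (lborel \<Otimes>\<^sub>M lborel) S \<le> ?b * emeasure lborel (ball c \<rho>)"
  proof (cases "1/2 \<le> t")
    case True
    have "emeasure lborel (Pair p -` S) \<le> indicator (ball c \<rho>) p * ?b" for p
    proof (cases "p \<in> ball c \<rho>")
      case p: True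
      have "Pair p -` S \<subseteq> cball ((1 / t) *\<^sub>R (u - (1 - t) *\<^sub>R p)) (2 * s)"
        using near[OF _ True] by (auto simp: S_def simp del: mem_cball)
      from small[OF this] p show ?thesis by simp
    qed (auto simp: S_def)
    then have "emeasure (lborel \<Otimes>\<^sub>M lborel) S \<le> (\<integral>\<^sup>+p. indicator (ball c \<rho>) p * ?b \<partial>lborel)"
      using meas by (subst lborel.emeasure_pair_measure_alt) (auto intro!: nn_integral_mono)
    then show ?thesis by (simp only: bound)
  next
    case False
    have "emeasure lborel ((\<lambda>p. (p, q)) -` S) \<le> indicator (ball c \<rho>) q * ?b" for q
    proof (cases "q \<in> ball c \<rho>")
      case q: True
      have "(\<lambda>p. (p, q)) -` S \<subseteq> cball ((1 / (1 - t)) *\<^sub>R (u - (1 - (1 - t)) *\<^sub>R q)) (2 * s)"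
      proof
        fix p assume "p \<in> (\<lambda>p. (p, q)) -` S"
        then have "dist ((1 - (1 - t)) *\<^sub>R q + (1 - t) *\<^sub>R p) u \<le> s"
          by (simp add: S_def add.commute)
        then show "p \<in> cball ((1 / (1 - t)) *\<^sub>R (u - (1 - (1 - t)) *\<^sub>R q)) (2 * s)"
          by (rule near) (use False in auto)
      qed
      from small[OF this] q show ?thesis by simp
    qed (auto simp: S_def)
    then have "emeasure (lborel \<Otimes>\<^sub>M lborel) S \<le> (\<integral>\<^sup>+q. indicator (ball c \<rho>) q * ?b \<partial>lborel)"
      using meas by (subst lborel_pair.emeasure_pair_measure_alt2) (auto intro!: nn_integral_mono)
    then show ?thesis by (simp only: bound)
  qed
qed

text \<open>
  The parameter \<open>t\<close> of a point of the segment is discretised with a step so small that the point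
  moves by at most \<open>s\<close>.  There are about \<open>\<rho> / s\<close> values of \<open>t\<close>, and each accounts for a proportion of
  order \<open>s ^ N / \<rho> ^ N\<close> of all pairs; the product has the exponent \<open>N - 1\<close> of the Hausdorff measure.
\<close>

lemma emeasure_segments_meeting_ball:
  fixes c u :: "'a::euclidean_space"
  assumes s: "0 < s" "s \<le> \<rho>"
  obtains Z where "Z \<in> sets (lborel \<Otimes>\<^sub>M lborel)"
    "\<And>p q. p \<in> ball c \<rho> \<Longrightarrow> q \<in> ball c \<rho> \<Longrightarrow> closed_segment p q \<inter> cball u s \<noteq> {} \<Longrightarrow> (p, q) \<in> Z"
    "emeasure (lborel \<Otimes>\<^sub>M lborel) Z
       \<le> ennreal (4 ^ Suc DIM('a) * unit_ball_vol DIM('a) * \<rho> * s ^ (DIM('a) - 1)) * emeasure lborel (ball c \<rho>)"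
proof -
  define J where "J = nat \<lceil>2 * \<rho> / s\<rceil>"
  have "1 < 2 * \<rho> / s" using s by (simp add: field_simps)
  then have J: "2 * \<rho> / s \<le> real J" "real J \<le> 2 * \<rho> / s + 1" "0 < J"
    unfolding J_def by linarith+
  define S where "S = (\<lambda>t. {(p, q). p \<in> ball c \<rho> \<and> q \<in> ball c \<rho> \<and>
      dist ((1 - t) *\<^sub>R p + t *\<^sub>R q) u \<le> 2 * s})"
  define Z where "Z = (\<Union>j\<in>{..J}. S (real j / real J))"
  let ?b = "unit_ball_vol DIM('a) * (2 * (2 * s)) ^ DIM('a)"
  have S: "S (real j / real J) \<in> sets (lborel \<Otimes>\<^sub>M lborel)"
    "emeasure (lborel \<Otimes>\<^sub>M lborel) (S (real j / real J)) \<le> ennreal ?b * emeasure lborel (ball c \<rho>)"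
    if "j \<le> J" for j
    using emeasure_pairs_combination_near_point[of "2 * s" "real j / real J" c \<rho> u] that s J(3)
    unfolding S_def by (auto simp: field_simps)
  have mZ: "Z \<in> sets (lborel \<Otimes>\<^sub>M lborel)"
    unfolding Z_def by (intro sets.finite_UN S) auto
  have "emeasure (lborel \<Otimes>\<^sub>M lborel) Z \<le> (\<Sum>j\<le>J. emeasure (lborel \<Otimes>\<^sub>M lborel) (S (real j / real J)))"
    unfolding Z_def using S(1) by (intro emeasure_subadditive_finite) auto
  also have "\<dots> \<le> (\<Sum>j\<le>J. ennreal ?b * emeasure lborel (ball c \<rho>))"
    by (intro sum_mono S) auto
  also have "\<dots> = ennreal ((real J + 1) * ?b) * emeasure lborel (ball c \<rho>)"
    using s by (simp add: ennreal_mult ennreal_of_nat_eq_real_of_nat mult.assoc ennreal_plus[symmetric] del: ennreal_plus)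
       (simp add: add.commute)
  also have "\<dots> \<le> ennreal (4 ^ Suc DIM('a) * unit_ball_vol DIM('a) * \<rho> * s ^ (DIM('a) - 1))
      * emeasure lborel (ball c \<rho>)"
  proof (intro mult_right_mono ennreal_leI)
    have "real J + 1 \<le> 4 * \<rho> / s"
      using J(2) s by (simp add: field_simps)
    then have "(real J + 1) * ?b \<le> 4 * \<rho> / s * ?b"
      using s by (intro mult_right_mono) auto
    also have "\<dots> = 4 ^ Suc DIM('a) * unit_ball_vol DIM('a) * \<rho> * (s ^ DIM('a) / s)"
      by (simp add: power_mult_distrib)
    also have "s ^ DIM('a) / s = s ^ (DIM('a) - 1)"
      using s by (simp add: power_diff)
    finally show "(real J + 1) * ?b \<le> 4 ^ Suc DIM('a) * unit_ball_vol DIM('a) * \<rho> * s ^ (DIM('a) - 1)" .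
  qed auto
  finally have eZ: "emeasure (lborel \<Otimes>\<^sub>M lborel) Z \<le> \<dots>" .
  have "(p, q) \<in> Z" if pq: "p \<in> ball c \<rho>" "q \<in> ball c \<rho>" and hit: "closed_segment p q \<inter> cball u s \<noteq> {}" for p q
  proof -
    from hit obtain t where t: "0 \<le> t" "t \<le> 1" and near: "dist ((1 - t) *\<^sub>R p + t *\<^sub>R q) u \<le> s"
      by (auto simp: closed_segment_def dist_commute)
    define j where "j = nat \<lfloor>t * real J\<rfloor>"
    have "t * real J \<le> real J" using t by (simp add: mult_left_le_one_le)
    then have j: "real j \<le> t * real J" "t * real J \<le> real j + 1" "j \<le> J"
      using t unfolding j_def by (auto simp: le_floor_iff nat_le_iff floor_le_iff)
    have "\<bar>t - real j / real J\<bar> \<le> 1 / real J"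
    proof -
      have "t - real j / real J = (t * real J - real j) / real J"
        using J(3) by (simp add: field_simps)
      moreover have "0 \<le> (t * real J - real j) / real J" using j(1) by simp
      moreover have "(t * real J - real j) / real J \<le> 1 / real J"
        using j(2) by (intro divide_right_mono) auto
      ultimately show ?thesis by linarith
    qed
    moreover have "dist p q \<le> 2 * \<rho>"
      using pq dist_triangle2[of p q c] by (simp add: dist_commute)
    ultimately have "\<bar>t - real j / real J\<bar> * dist p q \<le> 1 / real J * (2 * \<rho>)"
      by (intro mult_mono) auto
    also have "\<dots> \<le> s" using J(1,3) s by (simp add: field_simps)
    finally have "\<bar>t - real j / real J\<bar> * dist p q \<le> s" .
    moreover have "(1 - real j / real J) *\<^sub>R p + (real j / real J) *\<^sub>R q - ((1 - t) *\<^sub>R p + t *\<^sub>R q)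
        = (t - real j / real J) *\<^sub>R (p - q)"
      by (simp add: algebra_simps)
    then have "dist ((1 - real j / real J) *\<^sub>R p + (real j / real J) *\<^sub>R q) ((1 - t) *\<^sub>R p + t *\<^sub>R q)
        = \<bar>t - real j / real J\<bar> * dist p q"
      by (simp add: dist_norm)
    ultimately have "dist ((1 - real j / real J) *\<^sub>R p + (real j / real J) *\<^sub>R q) u \<le> 2 * s"
      using near dist_triangle[of "(1 - real j / real J) *\<^sub>R p + (real j / real J) *\<^sub>R q" u
          "(1 - t) *\<^sub>R p + t *\<^sub>R q"] by linarith
    then show ?thesis using pq j(3) by (auto simp: Z_def S_def)
  qed
  with mZ eZ that show ?thesis by blast
qed

lemma closed_segment_imp_connected_component:
  fixes p q :: "'a::real_normed_vector"
  shows
  "closed_segment p q \<subseteq> S \<Longrightarrow> connected_component S p q"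
  unfolding connected_component_def by (intro exI[of _ "closed_segment p q"]) auto

text \<open>
  Summing the previous bound over the cover, only a small proportion of the pairs of points of the
  ball span a segment that meets \<open>F\<close>.  By Fubini and Markov, all but few points \<open>p\<close> see at least two
  thirds of the ball along segments avoiding \<open>F\<close>.  Two such points see a common third point, so they
  are joined by two segments.
\<close>

lemma ball_minus_thin_cover_mostly_connected:
  fixes c :: "'a::euclidean_space" and u :: "nat \<Rightarrow> 'a"
  assumes dim: "2 \<le> DIM('a)" and \<rho>: "0 < \<rho>" and s: "\<And>i. 0 < s i"
    and cover: "F \<inter> ball c \<rho> \<subseteq> (\<Union>i. cball (u i) (s i))"
    and sum: "(\<Sum>i. ennreal (s i ^ (DIM('a) - 1)))
      \<le> ennreal (\<rho> ^ (DIM('a) - 1) / (3 * 4 ^ Suc DIM('a) * 8 ^ DIM('a)))"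
  obtains G where "G \<in> sets lborel" "G \<subseteq> ball c \<rho>"
    "emeasure lborel (ball c \<rho> - G) \<le> ennreal (unit_ball_vol DIM('a) * (\<rho> / 8) ^ DIM('a))"
    "\<And>p q. p \<in> G \<Longrightarrow> q \<in> G \<Longrightarrow> connected_component (ball c \<rho> - F) p q"
proof -
  define n where "n = DIM('a)"
  define \<omega> where "\<omega> = unit_ball_vol (real n)"
  define \<eta> :: real where "\<eta> = 1 / (3 * 4 ^ Suc n * 8 ^ n)"
  have \<omega>: "0 < \<omega>" by (simp add: \<omega>_def)
  have \<eta>: "0 < \<eta>" by (simp add: \<eta>_def)
  have "1 \<le> (3::real) * 4 ^ Suc n * 8 ^ n"
    by (simp add: mult_ge1_I)
  then have \<eta>1: "\<eta> \<le> 1" by (simp add: \<eta>_def)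
  have sum': "(\<Sum>i. ennreal (s i ^ (n - 1))) \<le> ennreal (\<eta> * \<rho> ^ (n - 1))"
    using sum by (simp add: n_def \<eta>_def)
  have s_le: "s i \<le> \<rho>" for i
  proof -
    have "ennreal (s i ^ (n - 1)) = (\<Sum>j\<in>{i}. ennreal (s j ^ (n - 1)))" by simp
    also have "\<dots> \<le> (\<Sum>j. ennreal (s j ^ (n - 1)))"
      by (rule sum_le_suminf) auto
    also have "\<dots> \<le> ennreal (\<eta> * \<rho> ^ (n - 1))" by (rule sum')
    also have "\<dots> \<le> ennreal (\<rho> ^ (n - 1))"
      using \<eta>1 \<eta> \<rho> by (intro ennreal_leI mult_left_le_one_le) auto
    finally have "s i ^ (n - 1) \<le> \<rho> ^ (n - 1)" using \<rho> by (simp add: ennreal_le_iff)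
    then show ?thesis
      using \<rho> s[of i] dim power_mono_iff[of "s i" \<rho> "n - 1"] by (simp add: n_def)
  qed
  let ?B = "ball c \<rho>" and ?M = "lborel \<Otimes>\<^sub>M lborel :: ('a \<times> 'a) measure"
  define \<beta> where "\<beta> = \<omega> * \<rho> ^ n"
  have \<beta>: "0 < \<beta>" "emeasure lborel ?B = ennreal \<beta>"
    using \<rho> \<omega> by (auto simp: \<beta>_def \<omega>_def n_def emeasure_ball)
  have "\<forall>i. \<exists>Z. Z \<in> sets ?M \<and>
      (\<forall>p q. p \<in> ?B \<longrightarrow> q \<in> ?B \<longrightarrow> closed_segment p q \<inter> cball (u i) (s i) \<noteq> {} \<longrightarrow> (p, q) \<in> Z) \<and>
      emeasure ?M Z \<le> ennreal (4 ^ Suc n * \<omega> * \<rho> * s i ^ (n - 1)) * emeasure lborel ?B"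
    (is "\<forall>i. \<exists>Z. ?P i Z")
  proof
    fix i
    from emeasure_segments_meeting_ball[OF s[of i] s_le[of i], where c = c and u = "u i"]
    obtain Z where "Z \<in> sets ?M"
      "\<And>p q. p \<in> ?B \<Longrightarrow> q \<in> ?B \<Longrightarrow> closed_segment p q \<inter> cball (u i) (s i) \<noteq> {} \<Longrightarrow> (p, q) \<in> Z"
      "emeasure ?M Z \<le> ennreal (4 ^ Suc n * \<omega> * \<rho> * s i ^ (n - 1)) * emeasure lborel ?B"
      unfolding n_def \<omega>_def by metis
    then show "\<exists>Z. ?P i Z"
      by blast
  qed
  from choice[OF this] obtain Z where Z: "\<forall>i. ?P i (Z i)" ..
  then have mZ: "\<And>i. Z i \<in> sets ?M"
    and hit: "\<And>i p q. p \<in> ?B \<Longrightarrow> q \<in> ?B \<Longrightarrow> closed_segment p q \<inter> cball (u i) (s i) \<noteq> {} \<Longrightarrow> (p, q) \<in> Z i"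
    and eZ: "\<And>i. emeasure ?M (Z i) \<le> ennreal (4 ^ Suc n * \<omega> * \<rho> * s i ^ (n - 1)) * emeasure lborel ?B"
    by blast+
  define W where "W = (\<Union>i. Z i)"
  have mW: "W \<in> sets ?M" unfolding W_def using mZ by auto
  have "emeasure ?M W \<le> (\<Sum>i. emeasure ?M (Z i))"
    unfolding W_def using mZ by (intro emeasure_subadditive_countably) auto
  also have "\<dots> \<le> (\<Sum>i. ennreal (4 ^ Suc n * \<omega> * \<rho> * \<beta>) * ennreal (s i ^ (n - 1)))"
  proof (intro suminf_le)
    fix i
    have "ennreal (4 ^ Suc n * \<omega> * \<rho> * s i ^ (n - 1)) * emeasure lborel ?B
        = ennreal (4 ^ Suc n * \<omega> * \<rho> * \<beta>) * ennreal (s i ^ (n - 1))"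
      using \<beta> \<omega> \<rho> s[of i] by (simp add: mult_ac flip: ennreal_mult)
    then show "emeasure ?M (Z i) \<le> ennreal (4 ^ Suc n * \<omega> * \<rho> * \<beta>) * ennreal (s i ^ (n - 1))"
      using eZ[of i] by simp
  qed auto
  also have "\<dots> = ennreal (4 ^ Suc n * \<omega> * \<rho> * \<beta>) * (\<Sum>i. ennreal (s i ^ (n - 1)))"
    by (rule ennreal_suminf_cmult)
  also have "\<dots> \<le> ennreal (4 ^ Suc n * \<omega> * \<rho> * \<beta>) * ennreal (\<eta> * \<rho> ^ (n - 1))"
    by (intro mult_left_mono sum') auto
  also have "\<dots> = ennreal (4 ^ Suc n * \<eta> * \<beta> * \<beta>)"
  proof -
    have "\<rho> * \<rho> ^ (n - 1) = \<rho> ^ n" using dim by (simp add: n_def flip: power_Suc)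
    then have "4 ^ Suc n * \<omega> * \<rho> * \<beta> * (\<eta> * \<rho> ^ (n - 1)) = 4 ^ Suc n * \<eta> * \<beta> * \<beta>"
      by (simp add: \<beta>_def mult_ac)
    then show ?thesis using \<omega> \<rho> \<beta> \<eta> by (simp flip: ennreal_mult)
  qed
  finally have eW: "emeasure ?M W \<le> ennreal (4 ^ Suc n * \<eta> * \<beta> * \<beta>)" .
  define f where "f = (\<lambda>p. emeasure lborel (Pair p -` W))"
  have mf: "f \<in> borel_measurable lborel"
    unfolding f_def using mW by (rule lborel.measurable_emeasure_Pair)
  have mslice: "Pair p -` W \<in> sets lborel" for p using mW by (rule sets_Pair1)
  \<comment> \<open>the points that see less than two thirds of the ball, as \<open>\<beta>\<close> is the volume of the ball\<close>
  define X where "X = {p \<in> ?B. 1 \<le> ennreal (3 / \<beta>) * f p}"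
  have mX: "X \<in> sets lborel"
    unfolding X_def using mf by measurable
  have "emeasure lborel X \<le> ennreal (3 / \<beta>) * (\<integral>\<^sup>+p. f p * indicator ?B p \<partial>lborel)"
    unfolding X_def
    by (intro nn_integral_Markov_inequality borel_measurable_times_ennreal mf borel_measurable_indicator) auto
  also have "\<dots> \<le> ennreal (3 / \<beta>) * (\<integral>\<^sup>+p. f p \<partial>lborel)"
    by (intro mult_left_mono nn_integral_mono) (auto simp: indicator_def)
  also have "(\<integral>\<^sup>+p. f p \<partial>lborel) = emeasure ?M W"
    unfolding f_def using mW by (rule lborel.emeasure_pair_measure_alt[symmetric])
  also have "ennreal (3 / \<beta>) * emeasure ?M W \<le> ennreal (3 / \<beta>) * ennreal (4 ^ Suc n * \<eta> * \<beta> * \<beta>)"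
    by (intro mult_left_mono eW) auto
  also have "\<dots> = ennreal (\<omega> * (\<rho> / 8) ^ n)"
  proof -
    have "3 / \<beta> * (4 ^ Suc n * \<eta> * \<beta> * \<beta>) = 3 * 4 ^ Suc n * \<eta> * \<beta>"
      using \<beta>(1) by simp
    also have "\<dots> = \<omega> * (\<rho> / 8) ^ n"
      by (simp add: \<eta>_def \<beta>_def power_divide)
    finally show ?thesis using \<beta>(1) \<eta> by (subst ennreal_mult[symmetric]) auto
  qed
  finally have eX: "emeasure lborel X \<le> ennreal (\<omega> * (\<rho> / 8) ^ n)" .
  show thesis
  proof (rule that[of "?B - X"])
    show "?B - X \<in> sets lborel" using mX by auto
    have "?B - (?B - X) = X" by (auto simp: X_def)
    then show "emeasure lborel (?B - (?B - X)) \<le> ennreal (unit_ball_vol DIM('a) * (\<rho> / 8) ^ DIM('a))"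
      using eX by (simp add: \<omega>_def n_def)
    fix p q assume "p \<in> ?B - X" "q \<in> ?B - X"
    then have p: "p \<in> ?B" "ennreal (3 / \<beta>) * f p \<le> 1" and q: "q \<in> ?B" "ennreal (3 / \<beta>) * f q \<le> 1"
      by (auto simp: X_def)
    have "\<not> ?B \<subseteq> Pair p -` W \<union> Pair q -` W"
    proof
      assume sub: "?B \<subseteq> Pair p -` W \<union> Pair q -` W"
      have "ennreal 3 = ennreal (3 / \<beta>) * ennreal \<beta>"
        using \<beta>(1) by (simp flip: ennreal_mult)
      also have "\<dots> = ennreal (3 / \<beta>) * emeasure lborel ?B" using \<beta>(2) by simp
      also have "\<dots> \<le> ennreal (3 / \<beta>) * emeasure lborel (Pair p -` W \<union> Pair q -` W)"
        using mslice by (intro mult_left_mono emeasure_mono sub) auto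
      also have "\<dots> \<le> ennreal (3 / \<beta>) * (f p + f q)"
        unfolding f_def using mslice by (intro mult_left_mono emeasure_subadditive) auto
      also have "\<dots> \<le> 1 + 1"
        unfolding distrib_left using p q by (intro add_mono)
      also have "\<dots> = ennreal 2" by simp
      finally show False by (simp add: ennreal_le_iff del: ennreal_numeral)
    qed
    then obtain m where m: "m \<in> ?B" "(p, m) \<notin> W" "(q, m) \<notin> W" by blast
    have conn: "connected_component (?B - F) x m" if x: "x \<in> ?B" "(x, m) \<notin> W" for x
    proof (rule closed_segment_imp_connected_component)
      have seg: "closed_segment x m \<subseteq> ?B"
        using x m(1) by (intro closed_segment_subset) auto
      moreover have "y \<notin> F" if y: "y \<in> closed_segment x m" for y
      proof
        assume "y \<in> F"
        with y seg cover obtain i where "y \<in> cball (u i) (s i)" by blast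
        with y have "closed_segment x m \<inter> cball (u i) (s i) \<noteq> {}" by blast
        from hit[OF x(1) m(1) this] x(2) show False by (auto simp: W_def)
      qed
      ultimately show "closed_segment x m \<subseteq> ?B - F" by blast
    qed
    from conn[OF p(1) m(2)] conn[OF q(1) m(3)]
    show "connected_component (?B - F) p q"
      by (meson connected_component_sym connected_component_trans)
  qed auto
qed

text \<open>
  A set is considered thin in a ball of radius \<open>\<rho>\<close> if its Hausdorff measure there is below this
  constant times \<open>\<rho> ^ (n - 1)\<close>.  Of the admissible sum of \<open>s i ^ (n - 1)\<close> over the radii of a cover,
  half is obtained from the Hausdorff measure and half is left to the slack, whence \<open>2 ^ n\<close> in place of
  \<open>2 ^ (n - 1)\<close>.
\<close>

definition thin_const :: "nat \<Rightarrow> real" where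
  "thin_const n = unit_ball_vol (real (n - 1)) / (2 ^ n * (3 * 4 ^ Suc n * 8 ^ n))"

lemma thin_const_pos: "0 < thin_const n"
  by (simp add: thin_const_def)

text \<open>
  A bulk is a piece of the ball that lies in a single component of the complement of \<open>F\<close> and misses
  at most the volume of a ball with one eighth of the radius.  This proportion is small enough for
  the bulks of two nearby balls to intersect.
\<close>

definition bulk :: "'a::euclidean_space set \<Rightarrow> 'a \<Rightarrow> real \<Rightarrow> 'a set \<Rightarrow> bool" where
  "bulk F c \<rho> G \<longleftrightarrow> G \<in> sets lborel \<and> G \<subseteq> ball c \<rho> \<and>
     emeasure lborel (ball c \<rho> - G) \<le> ennreal (unit_ball_vol DIM('a) * (\<rho> / 8) ^ DIM('a)) \<and>
     (\<forall>p\<in>G. \<forall>q\<in>G. connected_component (ball c \<rho> - F) p q)"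

lemma ball_minus_thin_set_has_bulk:
  fixes c :: "'a::euclidean_space"
  assumes dim: "2 \<le> DIM('a)" and \<rho>: "0 < \<rho>"
    and thin: "hausdorff_measure (DIM('a) - 1) (F \<inter> ball c \<rho>)
      < ennreal (thin_const DIM('a) * \<rho> ^ (DIM('a) - 1))"
  obtains G where "bulk F c \<rho> G"
proof -
  define d where "d = DIM('a) - 1"
  define \<kappa> :: real where "\<kappa> = 1 / (3 * 4 ^ Suc DIM('a) * 8 ^ DIM('a))"
  have d: "0 < d" "DIM('a) = Suc d" using dim by (auto simp: d_def)
  have \<kappa>: "0 < \<kappa>" by (simp add: \<kappa>_def)
  have pos: "0 < \<kappa> * \<rho> ^ d / 2" using \<kappa> \<rho> by simp
  obtain u :: "nat \<Rightarrow> 'a" and s where us: "\<And>i. 0 < s i" "F \<inter> ball c \<rho> \<subseteq> (\<Union>i. cball (u i) (s i))"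
    "(\<Sum>i. ennreal (s i ^ d)) \<le> ennreal (2 ^ d * (thin_const DIM('a) * \<rho> ^ d) / unit_ball_vol (real d) + \<kappa> * \<rho> ^ d / 2)"
    by (rule hausdorff_small_imp_ball_cover[OF thin[folded d_def] pos d(1)]) (rule that)
  have "thin_const DIM('a) = unit_ball_vol (real d) * \<kappa> / (2 * 2 ^ d)"
    by (simp add: thin_const_def \<kappa>_def d_def[symmetric] d(2))
  moreover have "unit_ball_vol (real d) \<noteq> 0"
    by (metis less_irrefl of_nat_0_le_iff unit_ball_vol_pos)
  ultimately have "2 ^ d * (thin_const DIM('a) * \<rho> ^ d) / unit_ball_vol (real d) + \<kappa> * \<rho> ^ d / 2 = \<kappa> * \<rho> ^ d"
    by simp
  then have sum: "(\<Sum>i. ennreal (s i ^ (DIM('a) - 1)))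
      \<le> ennreal (\<rho> ^ (DIM('a) - 1) / (3 * 4 ^ Suc DIM('a) * 8 ^ DIM('a)))"
    using us(3) by (simp add: \<kappa>_def d_def)
  show thesis
  proof (rule ball_minus_thin_cover_mostly_connected[OF dim \<rho> us(1,2) sum])
    fix G
    assume "G \<in> sets lborel" "G \<subseteq> ball c \<rho>"
      "emeasure lborel (ball c \<rho> - G) \<le> ennreal (unit_ball_vol DIM('a) * (\<rho> / 8) ^ DIM('a))"
      "\<And>p q. p \<in> G \<Longrightarrow> q \<in> G \<Longrightarrow> connected_component (ball c \<rho> - F) p q"
    then show thesis by (intro that[of G]) (simp add: bulk_def)
  qed
qed

text \<open>
  Both balls contain \<open>ball c (\<rho> / 2)\<close>, whose volume exceeds what the two bulks can miss together.
\<close>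

lemma bulks_of_nearby_balls_meet:
  fixes c c' :: "'a::euclidean_space"
  assumes dim: "2 \<le> DIM('a)" and \<rho>: "0 < \<rho>"
    and G: "bulk F c \<rho> G" and G': "bulk F c' \<rho>' G'"
    and near: "dist c c' < \<rho> / 4" "\<bar>\<rho> - \<rho>'\<bar> < \<rho> / 4"
  shows "G \<inter> G' \<noteq> {}"
proof
  assume disj: "G \<inter> G' = {}"
  define n where "n = DIM('a)"
  define \<omega> where "\<omega> = unit_ball_vol (real n)"
  have \<omega>: "0 < \<omega>" by (simp add: \<omega>_def)
  have \<rho>': "0 < \<rho>'" using \<rho> near(2) by linarith
  have sets: "ball c \<rho> - G \<in> sets lborel" "ball c' \<rho>' - G' \<in> sets lborel"
    using G G' by (auto simp: bulk_def)
  have "ball c (\<rho> / 2) \<subseteq> ball c' \<rho>'"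
  proof
    fix y assume "y \<in> ball c (\<rho> / 2)"
    then have "dist c' y < \<rho> / 4 + \<rho> / 2"
      using near(1) dist_triangle[of c' y c] by (simp add: dist_commute)
    moreover have "\<rho> - \<rho>' < \<rho> / 4" using near(2) by linarith
    ultimately show "y \<in> ball c' \<rho>'" by simp
  qed
  moreover have "ball c (\<rho> / 2) \<subseteq> ball c \<rho>" using \<rho> by auto
  ultimately have sub: "ball c (\<rho> / 2) \<subseteq> (ball c \<rho> - G) \<union> (ball c' \<rho>' - G')"
    using disj by blast
  have "ennreal (\<omega> * (\<rho> / 2) ^ n) = emeasure lborel (ball c (\<rho> / 2))"
    using \<rho> by (simp add: emeasure_ball \<omega>_def n_def)
  also have "\<dots> \<le> emeasure lborel ((ball c \<rho> - G) \<union> (ball c' \<rho>' - G'))"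
    using sets by (intro emeasure_mono sub) auto
  also have "\<dots> \<le> emeasure lborel (ball c \<rho> - G) + emeasure lborel (ball c' \<rho>' - G')"
    using sets by (rule emeasure_subadditive)
  also have "\<dots> \<le> ennreal (\<omega> * (\<rho> / 8) ^ n) + ennreal (\<omega> * (\<rho>' / 8) ^ n)"
    using G G' by (intro add_mono) (auto simp: bulk_def \<omega>_def n_def)
  also have "\<dots> = ennreal (\<omega> * (\<rho> / 8) ^ n + \<omega> * (\<rho>' / 8) ^ n)"
    using \<omega> \<rho> \<rho>' by (intro ennreal_plus[symmetric]) auto
  finally have "\<omega> * (\<rho> / 2) ^ n \<le> \<omega> * (\<rho> / 8) ^ n + \<omega> * (\<rho>' / 8) ^ n"
    using \<omega> \<rho> \<rho>' by (subst (asm) ennreal_le_iff) auto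
  then have "\<omega> * (\<rho> / 2) ^ n \<le> \<omega> * ((\<rho> / 8) ^ n + (\<rho>' / 8) ^ n)" by (simp add: distrib_left)
  then have "(\<rho> / 2) ^ n \<le> (\<rho> / 8) ^ n + (\<rho>' / 8) ^ n" using \<omega> by simp
  also have "\<dots> < (\<rho> / 4) ^ n + (\<rho> / 4) ^ n"
  proof (intro add_strict_mono power_strict_mono)
    show "\<rho>' / 8 < \<rho> / 4" using near(2) \<rho> by linarith
  qed (use \<rho> \<rho>' dim in \<open>auto simp: n_def\<close>)
  also have "\<dots> = 2 * (1/2) ^ n * (\<rho> / 2) ^ n"
    by (simp flip: power_mult_distrib)
  also have "\<dots> \<le> 1 * (\<rho> / 2) ^ n"
  proof (intro mult_right_mono)
    have "((1::real)/2) ^ n \<le> (1/2) ^ 1" using dim by (intro power_decreasing) (auto simp: n_def)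
    then show "2 * (1/2) ^ n \<le> (1::real)" by simp
  qed (use \<rho> in auto)
  finally show False by simp
qed

section \<open>Escaping along John curves\<close>

text \<open>
  A family of balls is regarded as a set of pairs of a centre and a radius.  The component of
  \<open>D - F\<close> that contains the bulk of a ball is a locally constant function of the pair, hence constant
  on a connected family.
\<close>

lemma connected_family_of_thin_balls:
  fixes D F :: "'a::euclidean_space set" and B :: "('a \<times> real) set"
  assumes dim: "2 \<le> DIM('a)" and conn: "connected B"
    and B: "\<And>c \<rho>. (c, \<rho>) \<in> B \<Longrightarrow> 0 < \<rho>" "\<And>c \<rho>. (c, \<rho>) \<in> B \<Longrightarrow> ball c \<rho> \<subseteq> D"
    and thin: "\<And>c \<rho>. (c, \<rho>) \<in> B \<Longrightarrow> hausdorff_measure (DIM('a) - 1) (F \<inter> ball c \<rho>)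
      < ennreal (thin_const DIM('a) * \<rho> ^ (DIM('a) - 1))"
    and in_B: "(c1, \<rho>1) \<in> B" "(c2, \<rho>2) \<in> B"
  shows "\<exists>p\<in>ball c1 \<rho>1. \<exists>q\<in>ball c2 \<rho>2. connected_component (D - F) p q"
proof -
  have "\<forall>b. \<exists>G. b \<in> B \<longrightarrow> bulk F (fst b) (snd b) G"
  proof (intro allI)
    fix b show "\<exists>G. b \<in> B \<longrightarrow> bulk F (fst b) (snd b) G"
    proof (cases "b \<in> B")
      case True
      then have "(fst b, snd b) \<in> B" by simp
      from ball_minus_thin_set_has_bulk[OF dim B(1)[OF this] thin[OF this]] show ?thesis by blast
    qed auto
  qed
  from choice[OF this] obtain G where G: "\<And>b. b \<in> B \<Longrightarrow> bulk F (fst b) (snd b) (G b)" by blast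
  have meet: "G b \<inter> G b' \<noteq> {}"
    if "b \<in> B" "b' \<in> B" "dist b b' < snd b / 4" for b b'
  proof (rule bulks_of_nearby_balls_meet[OF dim _ G G])
    show "dist (fst b) (fst b') < snd b / 4"
      using dist_fst_le[of b b'] that(3) by linarith
    show "\<bar>snd b - snd b'\<bar> < snd b / 4"
      using dist_snd_le[of b b'] that(3) by (simp add: dist_real_def)
    show "0 < snd b" using B(1)[of "fst b" "snd b"] that(1) by simp
  qed (use that in auto)
  have "\<exists>p. b \<in> B \<longrightarrow> p \<in> G b" for b
    using meet[of b b] B(1)[of "fst b" "snd b"] by auto
  then obtain pt where pt: "\<And>b. b \<in> B \<Longrightarrow> pt b \<in> G b" by metis
  have link: "connected_component (D - F) p q" if "b \<in> B" "p \<in> G b" "q \<in> G b" for b p q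
  proof (rule connected_component_of_subset)
    show "connected_component (ball (fst b) (snd b) - F) p q"
      using G[OF that(1)] that by (auto simp: bulk_def)
    show "ball (fst b) (snd b) - F \<subseteq> D - F" using B(2)[of "fst b" "snd b"] that(1) by auto
  qed
  have "connected_component_set (D - F) (pt (c1, \<rho>1)) = connected_component_set (D - F) (pt (c2, \<rho>2))"
  proof (rule connected_local_const[OF conn in_B], rule ballI)
    fix b assume b: "b \<in> B"
    have "connected_component_set (D - F) (pt b) = connected_component_set (D - F) (pt b')"
      if b': "b' \<in> B" "dist b' b < snd b / 4" for b'
    proof -
      obtain m where "m \<in> G b" "m \<in> G b'"
        using meet[OF b b'(1)] b'(2) by (auto simp: dist_commute)
      then have "connected_component (D - F) (pt b) (pt b')"
        using link[OF b pt[OF b]] link[OF b'(1) _ pt[OF b'(1)]] connected_component_trans by blast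
      then show ?thesis by (rule connected_component_eq[symmetric, OF CollectI])
    qed
    moreover have "0 < snd b / 4" using B(1)[of "fst b" "snd b"] b by simp
    ultimately show "\<forall>\<^sub>F b' in at b within B.
        connected_component_set (D - F) (pt b) = connected_component_set (D - F) (pt b')"
      unfolding eventually_at by (intro exI[of _ "snd b / 4"]) simp
  qed
  moreover have "pt (c2, \<rho>2) \<in> connected_component_set (D - F) (pt (c2, \<rho>2))"
    using link[OF in_B(2) pt[OF in_B(2)] pt[OF in_B(2)]] by simp
  ultimately have "pt (c2, \<rho>2) \<in> connected_component_set (D - F) (pt (c1, \<rho>1))"
    by (simp only:)
  then have "connected_component (D - F) (pt (c1, \<rho>1)) (pt (c2, \<rho>2))" by (rule CollectD)
  moreover have "pt (c1, \<rho>1) \<in> ball c1 \<rho>1" "pt (c2, \<rho>2) \<in> ball c2 \<rho>2"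
    using G[OF in_B(1)] pt[OF in_B(1)] G[OF in_B(2)] pt[OF in_B(2)] by (auto simp: bulk_def)
  ultimately show ?thesis by blast
qed

lemma ball_subset_if_le_infdist:
  "\<rho> \<le> infdist x (- D) \<Longrightarrow> ball x \<rho> \<subseteq> D"
  using infdist_le[of _ "- D" x] by (force simp: not_le)

text \<open>
  The form in which the John condition is used: along the curve, \<open>ball (\<gamma> t) (t / C)\<close> stays in the
  domain, while its centre is at distance at most \<open>C * t\<close> from the starting point.
\<close>

lemma john_curve_balls:
  fixes D :: "'a::euclidean_space set"
  assumes "john_domain_center C z0 D" and "z \<in> D"
  obtains \<gamma> :: "real \<Rightarrow> 'a" where "\<gamma> 0 = z" "\<gamma> (dist z z0) = z0"
    "continuous_on {0..dist z z0} \<gamma>"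
    "\<And>t. t \<in> {0..dist z z0} \<Longrightarrow> dist z (\<gamma> t) \<le> C * t"
    "\<And>t. t \<in> {0..dist z z0} \<Longrightarrow> ball (\<gamma> t) (t / C) \<subseteq> D"
proof -
  obtain \<gamma> :: "real \<Rightarrow> 'a" where \<gamma>: "C-lipschitz_on {0..dist z z0} \<gamma>" "\<gamma> 0 = z" "\<gamma> (dist z z0) = z0"
    "\<And>t. t \<in> {0..dist z z0} \<Longrightarrow> t / C \<le> infdist (\<gamma> t) (- D)"
    using assms unfolding john_domain_center_def by blast
  show thesis
  proof (rule that)
    show "continuous_on {0..dist z z0} \<gamma>" using \<gamma>(1) by (rule lipschitz_on_continuous_on)
    show "dist z (\<gamma> t) \<le> C * t" if "t \<in> {0..dist z z0}" for t
      using lipschitz_onD[OF \<gamma>(1), of 0 t] that \<gamma>(2) by (simp add: dist_real_def)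
    show "ball (\<gamma> t) (t / C) \<subseteq> D" if "t \<in> {0..dist z z0}" for t
      using \<gamma>(4)[OF that] by (rule ball_subset_if_le_infdist)
  qed (use \<gamma> in auto)
qed

text \<open>
  The centre \<open>z0\<close> may well lie inside \<open>ball x0 r\<close>, so the John curve from \<open>z\<close> to \<open>z0\<close> does not have to
  leave it.  Therefore a second John curve, from a point \<open>z'\<close> in the middle of the shell to \<open>z0\<close>, is
  followed backwards.  The radii attached to \<open>z0\<close> by the two curves differ in general, and the family
  of balls is made connected by concentric balls at \<open>z0\<close>.  All balls of the family have their distance
  from \<open>z\<close> bounded by a multiple of their radius: on the first curve by the carrot shape, and on the
  second because it is followed only as long as its radii are comparable with \<open>r\<close>.
\<close>

lemma john_domain_escape:
  fixes D F :: "'a::euclidean_space set"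
  assumes dim: "2 \<le> DIM('a)" and r: "0 < r"
    and john: "john_domain_center C z0 D"
    and D: "D \<subseteq> ball x0 (2 * r)" "ball x0 (2 * r) - cball x0 r \<subseteq> D"
    and DF: "open (D - F)" and z: "z \<in> D - F" "z \<noteq> z0"
    and thin: "\<And>c \<rho>. 0 < \<rho> \<Longrightarrow> ball c \<rho> \<subseteq> D \<Longrightarrow> dist z c \<le> 16 * C\<^sup>2 * \<rho> \<Longrightarrow>
      hausdorff_measure (DIM('a) - 1) (F \<inter> ball c \<rho>) < ennreal (thin_const DIM('a) * \<rho> ^ (DIM('a) - 1))"
  shows "\<exists>y. y \<notin> cball x0 r \<and> connected_component (D - F) z y"
proof -
  have C: "1 \<le> C" and z0: "z0 \<in> D" using john by (auto simp: john_domain_center_def)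
  have C2: "1 \<le> C\<^sup>2" "C \<le> C\<^sup>2" using C by (auto simp: power2_eq_square mult_ge1_I)
  define l where "l = dist z z0"
  have l: "0 < l" using z(2) by (simp add: l_def)
  have distD: "dist p q \<le> 4 * r" if "p \<in> D" "q \<in> D" for p q
  proof -
    have "dist x0 p < 2 * r" "dist x0 q < 2 * r" using that D(1) by auto
    then show ?thesis using dist_triangle[of p q x0] by (simp add: dist_commute)
  qed
  \<comment> \<open>of two antipodal points of the shell, one is far from the centre \<open>z0\<close>\<close>
  obtain z' where z': "dist x0 z' = 3/2 * r" "3/2 * r \<le> dist z' z0"
  proof -
    obtain e :: 'a where e: "norm e = 1" using vector_choose_size[of 1] by auto
    define a where "a = x0 + (3/2 * r) *\<^sub>R e"
    define b where "b = x0 - (3/2 * r) *\<^sub>R e"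
    have ab: "dist x0 a = 3/2 * r" "dist x0 b = 3/2 * r"
      using r e by (auto simp: a_def b_def dist_norm)
    have "a - b = (3 * r) *\<^sub>R e" by (simp add: a_def b_def flip: scaleR_left_distrib)
    then have "dist a b = 3 * r" using r e by (simp add: dist_norm)
    moreover have "dist a b \<le> dist a z0 + dist b z0" by (rule dist_triangle2)
    ultimately have "3/2 * r \<le> dist a z0 \<or> 3/2 * r \<le> dist b z0" by linarith
    with ab that show thesis by blast
  qed
  have z'D: "z' \<in> D" using z'(1) r D(2) by auto
  define l' where "l' = dist z' z0"
  \<comment> \<open>at this parameter the ball on the second curve still lies outside \<open>cball x0 r\<close>\<close>
  define t' where "t' = r / (4 * C)"
  have t'r: "t' \<le> r / 4" "0 < t'" "C * t' = r / 4" using C r by (auto simp: t'_def field_simps)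
  then have t': "t' \<le> l'" "0 < l'" "r \<le> l'" using z'(2) r unfolding l'_def by linarith+
  from john_curve_balls[OF john, of z, folded l_def] z(1)
  obtain \<gamma> where \<gamma>: "\<gamma> 0 = z" "\<gamma> l = z0" "continuous_on {0..l} \<gamma>"
    "\<And>t. t \<in> {0..l} \<Longrightarrow> dist z (\<gamma> t) \<le> C * t" "\<And>t. t \<in> {0..l} \<Longrightarrow> ball (\<gamma> t) (t / C) \<subseteq> D"
    by blast
  from john_curve_balls[OF john z'D, folded l'_def]
  obtain \<gamma>' where \<gamma>': "\<gamma>' 0 = z'" "\<gamma>' l' = z0" "continuous_on {0..l'} \<gamma>'"
    "\<And>t. t \<in> {0..l'} \<Longrightarrow> dist z' (\<gamma>' t) \<le> C * t" "\<And>t. t \<in> {0..l'} \<Longrightarrow> ball (\<gamma>' t) (t / C) \<subseteq> D"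
    by blast
  define L1 where "L1 = (\<lambda>t. (\<gamma> t, t / C)) ` {0<..l}"
  define L2 where "L2 = Pair z0 ` {min l l' / C..max l l' / C}"
  define L3 where "L3 = (\<lambda>t. (\<gamma>' t, t / C)) ` {t'..l'}"
  have "continuous_on {0<..l} (\<lambda>t. (\<gamma> t, t / C))" using C
    by (intro continuous_intros continuous_on_subset[OF \<gamma>(3)]) auto
  moreover have "continuous_on {t'..l'} (\<lambda>t. (\<gamma>' t, t / C))" using C t'r
    by (intro continuous_intros continuous_on_subset[OF \<gamma>'(3)]) auto
  moreover have "continuous_on {min l l' / C..max l l' / C} (Pair z0)" by (intro continuous_intros)
  ultimately have conn: "connected L1" "connected L2" "connected L3"
    unfolding L1_def L2_def L3_def by (auto intro: connected_continuous_image)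
  have mm: "min l l' / C \<le> l / C" "l / C \<le> max l l' / C" "min l l' / C \<le> l' / C" "l' / C \<le> max l l' / C"
    using C by (auto intro!: divide_right_mono)
  have "(z0, l / C) \<in> L1 \<inter> L2"
    using \<gamma>(2) l mm unfolding L1_def L2_def by (auto intro!: image_eqI[of _ _ l])
  with conn have "connected (L1 \<union> L2)" by (intro connected_Un) auto
  moreover have "(z0, l' / C) \<in> (L1 \<union> L2) \<inter> L3"
    using \<gamma>'(2) t' mm unfolding L2_def L3_def by (auto intro!: image_eqI[of _ _ l'])
  ultimately have connB: "connected (L1 \<union> L2 \<union> L3)" using conn(3) by (intro connected_Un[of "L1 \<union> L2"]) auto
  have B: "0 < \<rho> \<and> ball c \<rho> \<subseteq> D \<and> dist z c \<le> 16 * C\<^sup>2 * \<rho>" if "(c, \<rho>) \<in> L1 \<union> L2 \<union> L3" for c \<rho>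
    using that
  proof (elim UnE)
    assume "(c, \<rho>) \<in> L1"
    then obtain t where t: "0 < t" "t \<le> l" "c = \<gamma> t" "\<rho> = t / C" by (auto simp: L1_def)
    have "dist z c \<le> C * t" using \<gamma>(4)[of t] t by simp
    also have "\<dots> = C\<^sup>2 * \<rho>" using t C by (simp add: power2_eq_square)
    also have "\<dots> \<le> 16 * C\<^sup>2 * \<rho>" using t C by (intro mult_right_mono) auto
    finally show ?thesis using t C \<gamma>(5)[of t] by simp
  next
    assume "(c, \<rho>) \<in> L2"
    then have c: "c = z0" and \<rho>: "min l l' / C \<le> \<rho>" "\<rho> \<le> max l l' / C" by (auto simp: L2_def)
    have "0 < min l l' / C" using l t' C by simp
    with \<rho> have pos: "0 < \<rho>" by linarith
    have "ball z0 (l / C) \<subseteq> D" "ball z0 (l' / C) \<subseteq> D"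
      using \<gamma>(5)[of l] \<gamma>(2) \<gamma>'(5)[of l'] \<gamma>'(2) l t' by auto
    then have "ball z0 (max l l' / C) \<subseteq> D" by (simp add: max_def)
    then have "ball c \<rho> \<subseteq> D" using \<rho>(2) c subset_ball by blast
    moreover have "dist z c \<le> 16 * C\<^sup>2 * \<rho>"
    proof (cases "l \<le> l'")
      case True
      then have "l \<le> C * \<rho>" using \<rho>(1) C by (simp add: field_simps)
      also have "\<dots> \<le> C\<^sup>2 * \<rho>" using C2 pos by (intro mult_right_mono) auto
      also have "\<dots> \<le> 16 * C\<^sup>2 * \<rho>" using C2 pos by simp
      finally show ?thesis using c by (simp add: l_def)
    next
      case False
      then have "l' \<le> C * \<rho>" using \<rho>(1) C by (simp add: field_simps)
      also have "\<dots> \<le> C\<^sup>2 * \<rho>" using C2 pos by (intro mult_right_mono) auto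
      finally have "dist z c \<le> 4 * (C\<^sup>2 * \<rho>)" using distD[of z z0] z z0 c t'(3) by auto
      also have "\<dots> \<le> 16 * C\<^sup>2 * \<rho>" using C2 pos by simp
      finally show ?thesis .
    qed
    ultimately show ?thesis using pos by simp
  next
    assume "(c, \<rho>) \<in> L3"
    then obtain t where t: "t' \<le> t" "t \<le> l'" "c = \<gamma>' t" "\<rho> = t / C" by (auto simp: L3_def)
    have pos: "0 < \<rho>" using t t'r C by simp
    have sub: "ball c \<rho> \<subseteq> D" using \<gamma>'(5)[of t] t t'r by simp
    then have "c \<in> D" using pos by auto
    then have "dist z c \<le> 4 * r" using distD[of z c] z by auto
    also have "\<dots> = 16 * (C * t')" using t'r by simp
    also have "\<dots> \<le> 16 * (C * t)" using t C by simp
    also have "\<dots> = 16 * C\<^sup>2 * \<rho>" using t C by (simp add: power2_eq_square)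
    finally show ?thesis using pos sub by simp
  qed
  \<comment> \<open>the first curve starts with balls so close to \<open>z\<close> that they avoid \<open>F\<close>\<close>
  obtain e where e: "0 < e" "ball z e \<subseteq> D - F" using DF z(1) by (meson open_contains_ball)
  define t where "t = min l (e / (2 * C))"
  have t: "0 < t" "t \<le> l" "2 * C * t \<le> e"
  proof -
    have "2 * C * t \<le> 2 * C * (e / (2 * C))" using C by (intro mult_left_mono) (auto simp: t_def)
    then show "2 * C * t \<le> e" using C by simp
  qed (use l e C in \<open>auto simp: t_def\<close>)
  have in_B: "(\<gamma> t, t / C) \<in> L1 \<union> L2 \<union> L3" "(\<gamma>' t', t' / C) \<in> L1 \<union> L2 \<union> L3"
    using t t' by (auto simp: L1_def L3_def)
  have "\<exists>p\<in>ball (\<gamma> t) (t / C). \<exists>q\<in>ball (\<gamma>' t') (t' / C). connected_component (D - F) p q"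
  proof (rule connected_family_of_thin_balls[OF dim connB _ _ _ in_B])
    fix c \<rho> assume "(c, \<rho>) \<in> L1 \<union> L2 \<union> L3"
    from B[OF this] have b: "0 < \<rho>" "ball c \<rho> \<subseteq> D" "dist z c \<le> 16 * C\<^sup>2 * \<rho>" by blast+
    show "0 < \<rho>" "ball c \<rho> \<subseteq> D" by (fact b)+
    from thin[OF b] show "hausdorff_measure (DIM('a) - 1) (F \<inter> ball c \<rho>)
        < ennreal (thin_const DIM('a) * \<rho> ^ (DIM('a) - 1))" .
  qed
  then obtain p q where pq: "p \<in> ball (\<gamma> t) (t / C)" "q \<in> ball (\<gamma>' t') (t' / C)"
    "connected_component (D - F) p q" by blast
  have tC: "t / C \<le> C * t" "t' / C \<le> C * t'"
  proof -
    have "x / C \<le> C * x" if "0 < x" for x :: real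
    proof -
      have "x * 1 \<le> x * C\<^sup>2" using C2 that by (intro mult_left_mono) auto
      then show ?thesis using C by (simp add: field_simps power2_eq_square)
    qed
    then show "t / C \<le> C * t" "t' / C \<le> C * t'" using t t'r by auto
  qed
  have "dist z p < e"
    using \<gamma>(4)[of t] t tC(1) pq(1) dist_triangle[of z p "\<gamma> t"] by simp
  then have "closed_segment z p \<subseteq> D - F"
    using e by (intro order_trans[OF closed_segment_subset e(2)]) auto
  with pq(3) have "connected_component (D - F) z q"
    using closed_segment_imp_connected_component connected_component_trans by blast
  moreover have "dist z' q < r / 2"
    using \<gamma>'(4)[of t'] t' t'r tC(2) pq(2) dist_triangle[of z' q "\<gamma>' t'"] by simp
  then have "q \<notin> cball x0 r"
    using z'(1) dist_triangle2[of x0 z' q] by simp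
  ultimately show ?thesis by blast
qed

text \<open>
  A path that avoids only the part of \<open>F\<close> in \<open>cball x0 r\<close>, and that runs in \<open>V\<close> only as long as it stays
  there, is cut at the first point where it reaches the sphere.  The initial piece lies in \<open>V - F\<close>,
  and its end point is a point of \<open>V\<close> outside the open ball.
\<close>

lemma escape_inside_component:
  fixes \<Omega> D F V :: "'a::euclidean_space set"
  assumes r: "0 < r" and V: "V \<subseteq> \<Omega>" and D: "D \<inter> cball x0 r \<subseteq> V"
    and z: "z \<in> ball x0 r" and y: "y \<notin> cball x0 r"
    and op: "open (D - F \<inter> cball x0 r)"
    and zy: "connected_component (D - F \<inter> cball x0 r) z y"
  shows "\<exists>v\<in>V - ball x0 r. connected_component (\<Omega> - F) z v"
proof -
  from op zy have "path_component (D - F \<inter> cball x0 r) z y"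
    by (simp add: open_path_connected_component)
  then obtain g where g: "path g" "path_image g \<subseteq> D - F \<inter> cball x0 r" "pathstart g = z" "pathfinish g = y"
    unfolding path_component_def by blast
  have "pathstart g \<in> closure (ball x0 r)" "pathfinish g \<notin> ball x0 r"
    using g z y closure_subset[of "ball x0 r"] by auto
  from exists_path_subpath_to_frontier[OF g(1) this]
  obtain h where h: "path h" "pathstart h = pathstart g" "path_image h \<subseteq> path_image g"
    "path_image h - {pathfinish h} \<subseteq> interior (ball x0 r)" "pathfinish h \<in> frontier (ball x0 r)"
    by blast
  have fin: "pathfinish h \<in> sphere x0 r" using h(5) r by (simp add: frontier_ball)
  have "path_image h \<subseteq> cball x0 r"
  proof
    fix w assume "w \<in> path_image h"
    then have "w = pathfinish h \<or> w \<in> ball x0 r" using h(4) by auto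
    then show "w \<in> cball x0 r" using fin by auto
  qed
  then have VF: "path_image h \<subseteq> V - F" using h(3) g(2) D by blast
  have "connected_component (\<Omega> - F) z (pathfinish h)"
    unfolding connected_component_def
    using h(1,2) g(3) VF V pathstart_in_path_image[of h] pathfinish_in_path_image[of h]
    by (intro exI[of _ "path_image h"]) (auto simp: connected_path_image)
  moreover have "pathfinish h \<in> V - ball x0 r"
    using fin VF pathfinish_in_path_image[of h] by auto
  ultimately show ?thesis by blast
qed

section \<open>The competitor is thick near the points it removes\<close>

text \<open>
  If every ball at controlled distance from \<open>x\<close> were thin, both components near \<open>x\<close> would be
  connected to the outside of \<open>ball x0 r\<close> within \<open>\<Omega> - F\<close>, and \<open>F\<close> would merge them.  The John condition
  is applied in the large ball \<open>ball x0 (2 * r)\<close> and not around \<open>x\<close>, since the way out has to reach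
  the complement of \<open>ball x0 r\<close>.
\<close>

lemma thick_ball_near_removed_point:
  fixes \<Omega> K F :: "'a::euclidean_space set"
  assumes dim: "2 \<le> DIM('a)" and op: "open \<Omega>" and K: "closedin (top_of_set \<Omega>) K"
    and r: "0 < r" "ball x0 (2 * r) \<subseteq> \<Omega>"
    and two: "\<And>\<epsilon>. 0 < \<epsilon> \<Longrightarrow> ball x \<epsilon> \<subseteq> \<Omega> \<Longrightarrow>
      \<exists>V \<in> components (\<Omega> - K). \<exists>W \<in> components (\<Omega> - K).
         V \<noteq> W \<and> V \<inter> ball x \<epsilon> \<noteq> {} \<and> W \<inter> ball x \<epsilon> \<noteq> {}"
    and john: "\<And>V. V \<in> components (\<Omega> - K) \<Longrightarrow>
      john_domain C ((V \<inter> ball x0 (2 * r)) \<union> (ball x0 (2 * r) - cball x0 r))"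
    and comp: "topological_competitor \<Omega> K x0 r F"
    and x: "x \<in> K - F"
  shows "\<exists>c \<rho>. 0 < \<rho> \<and> \<rho> \<le> 2 * r \<and> dist x c \<le> (32 * C\<^sup>2 + 1) * \<rho> \<and>
    ennreal (thin_const DIM('a) * \<rho> ^ (DIM('a) - 1)) \<le> hausdorff_measure (DIM('a) - 1) ((F - K) \<inter> ball c \<rho>)"
proof (rule ccontr)
  assume "\<not> ?thesis"
  then have thin: "hausdorff_measure (DIM('a) - 1) ((F - K) \<inter> ball c \<rho>)
      < ennreal (thin_const DIM('a) * \<rho> ^ (DIM('a) - 1))"
    if "0 < \<rho>" "\<rho> \<le> 2 * r" "dist x c \<le> (32 * C\<^sup>2 + 1) * \<rho>" for c \<rho>
    using that by (meson not_le)
  have F: "closedin (top_of_set \<Omega>) F" and out: "F - ball x0 r = K - ball x0 r"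
    and sep: "\<And>v w. v \<in> \<Omega> - (ball x0 r \<union> K) \<Longrightarrow> w \<in> \<Omega> - (ball x0 r \<union> K) \<Longrightarrow>
      connected_component_set (\<Omega> - K) v \<noteq> connected_component_set (\<Omega> - K) w \<Longrightarrow>
      connected_component_set (\<Omega> - F) v \<noteq> connected_component_set (\<Omega> - F) w"
    using comp unfolding topological_competitor_def by blast+
  have xb: "x \<in> ball x0 r" using x out by blast
  have opn: "open (\<Omega> - F)" "open (\<Omega> - K)"
    using op F K by (metis closedin_def open_openin_trans openin_open_trans topspace_euclidean_subtopology)+
  have "x \<in> (\<Omega> - F) \<inter> ball x0 r" using xb x K closedin_imp_subset by blast
  moreover have "open ((\<Omega> - F) \<inter> ball x0 r)" using opn by auto
  ultimately obtain \<epsilon>0 where \<epsilon>0: "0 < \<epsilon>0" "ball x \<epsilon>0 \<subseteq> (\<Omega> - F) \<inter> ball x0 r"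
    by (meson open_contains_ball)
  define \<epsilon> where "\<epsilon> = \<epsilon>0 / 2"
  have \<epsilon>: "0 < \<epsilon>" "ball x \<epsilon> \<subseteq> ball x \<epsilon>0" using \<epsilon>0 by (auto simp: \<epsilon>_def)
  have reach: "\<exists>z\<in>ball x \<epsilon>. \<exists>v\<in>V - ball x0 r. connected_component (\<Omega> - F) z v"
    if V: "V \<in> components (\<Omega> - K)" and meets: "V \<inter> ball x \<epsilon> \<noteq> {}" for V
  proof -
    let ?D = "(V \<inter> ball x0 (2 * r)) \<union> (ball x0 (2 * r) - cball x0 r)"
    let ?F = "F \<inter> cball x0 r"
    have opV: "open V" using opn(2) V by (rule open_components)
    have VK: "V \<subseteq> \<Omega> - K" using V by (rule in_components_subset)
    obtain z0 where center: "john_domain_center C z0 ?D" using john[OF V] by (auto simp: john_domain_def)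
    \<comment> \<open>for \<open>z = z0\<close> the John curve would have length zero and there would be no ball to start from\<close>
    obtain z where z: "z \<in> V" "z \<in> ball x \<epsilon>" "z \<noteq> z0"
    proof -
      have "open (V \<inter> ball x \<epsilon>)" using opV by auto
      then have "V \<inter> ball x \<epsilon> \<noteq> {z0}" by (metis not_open_singleton)
      with meets that show thesis by blast
    qed
    have zb: "z \<in> ball x0 r" "z \<notin> F" using z(2) \<epsilon>(2) \<epsilon>0(2) by blast+
    have zD: "z \<in> ?D - ?F" using z(1) zb r by auto
    have D\<Omega>: "?D \<subseteq> \<Omega>" using r(2) by auto
    have "?D - ?F = ?D \<inter> ((\<Omega> - F) \<union> - cball x0 r)" using D\<Omega> by blast
    moreover have "open ?D" using opV by (intro open_Un open_Int open_Diff) auto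
    moreover have "open ((\<Omega> - F) \<union> - cball x0 r)" using opn(1) by (intro open_Un) auto
    ultimately have opD: "open (?D - ?F)" by (simp add: open_Int)
    \<comment> \<open>a ball that meets \<open>F\<close> reaches a distance of at least \<open>2 * \<epsilon>\<close> from \<open>x\<close>, so \<open>\<epsilon>\<close> is absorbed in the bound for \<open>dist x c\<close>\<close>
    have thin': "hausdorff_measure (DIM('a) - 1) (?F \<inter> ball c \<rho>)
        < ennreal (thin_const DIM('a) * \<rho> ^ (DIM('a) - 1))"
      if \<rho>: "0 < \<rho>" and sub: "ball c \<rho> \<subseteq> ?D" and zc: "dist z c \<le> 16 * C\<^sup>2 * \<rho>" for c \<rho>
    proof (cases "?F \<inter> ball c \<rho> = {}")
      case True
      then show ?thesis using \<rho> thin_const_pos[of "DIM('a)"] by (simp add: hausdorff_measure_empty)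
    next
      case False
      then obtain w where w: "w \<in> F" "dist c w < \<rho>" by auto
      have "w \<notin> ball x \<epsilon>0" using w(1) \<epsilon>0 by auto
      then have "2 * \<epsilon> \<le> dist x c + \<rho>" using w(2) dist_triangle[of x w c] by (simp add: \<epsilon>_def)
      moreover have "dist x c \<le> \<epsilon> + 16 * C\<^sup>2 * \<rho>"
        using z(2) zc dist_triangle[of x c z] by simp
      ultimately have "dist x c \<le> (32 * C\<^sup>2 + 1) * \<rho>" by (simp add: algebra_simps)
      moreover have "\<rho> \<le> 2 * r"
      proof -
        have "ball c \<rho> \<subseteq> ball x0 (2 * r)" using sub by auto
        then have "dist c x0 + \<rho> \<le> 2 * r" using \<rho> by (simp add: ball_subset_ball_iff)
        then show ?thesis using zero_le_dist[of c x0] by linarith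
      qed
      ultimately have "hausdorff_measure (DIM('a) - 1) ((F - K) \<inter> ball c \<rho>)
          < ennreal (thin_const DIM('a) * \<rho> ^ (DIM('a) - 1))" using \<rho> by (intro thin)
      moreover have "?F \<inter> ball c \<rho> \<subseteq> (F - K) \<inter> ball c \<rho>" using sub VK by blast
      ultimately show ?thesis using hausdorff_measure_mono le_less_trans by blast
    qed
    from john_domain_escape[OF dim r(1) center _ _ opD zD z(3) thin']
    obtain y where "y \<notin> cball x0 r" "connected_component (?D - ?F) z y" by blast
    then show ?thesis
      using escape_inside_component[OF r(1) _ _ zb(1) _ opD, of V \<Omega> y] VK z(2) by blast
  qed
  have "ball x \<epsilon> \<subseteq> \<Omega>" using \<epsilon> \<epsilon>0 by blast
  with two[OF \<epsilon>(1)] obtain V W where VW: "V \<in> components (\<Omega> - K)" "W \<in> components (\<Omega> - K)" "V \<noteq> W"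
    "V \<inter> ball x \<epsilon> \<noteq> {}" "W \<inter> ball x \<epsilon> \<noteq> {}" by blast
  obtain z v where v: "z \<in> ball x \<epsilon>" "v \<in> V - ball x0 r" "connected_component (\<Omega> - F) z v"
    using reach[OF VW(1,4)] by blast
  obtain z' w where w: "z' \<in> ball x \<epsilon>" "w \<in> W - ball x0 r" "connected_component (\<Omega> - F) z' w"
    using reach[OF VW(2,5)] by blast
  have "closed_segment z z' \<subseteq> ball x \<epsilon>" using v(1) w(1) by (intro closed_segment_subset) auto
  then have "connected_component (\<Omega> - F) z z'"
    using \<epsilon> \<epsilon>0 by (intro closed_segment_imp_connected_component) auto
  then have vw: "connected_component_set (\<Omega> - F) v = connected_component_set (\<Omega> - F) w"
    using v(3) w(3) by (metis connected_component_eq_eq connected_component_sym connected_component_trans connected_component_eq mem_Collect_eq)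
  have "connected_component_set (\<Omega> - K) v = V" "connected_component_set (\<Omega> - K) w = W"
    using v(2) w(2) VW(1,2) by (metis Diff_iff joinable_components_eq connected_component_eq components_iff)+
  then have "connected_component_set (\<Omega> - K) v \<noteq> connected_component_set (\<Omega> - K) w" using VW(3) by simp
  moreover have "v \<in> \<Omega> - (ball x0 r \<union> K)" "w \<in> \<Omega> - (ball x0 r \<union> K)"
    using v(2) w(2) VW(1,2) in_components_subset by blast+
  ultimately show False using sep vw by blast
qed

section \<open>Comparing the set with its competitor by a covering argument\<close>

theorem theorem6p7:
  fixes C0 :: real
  assumes "2 \<le> CARD('n::finite)" and "2 \<le> C0"
  shows "\<exists>M::real. 1 \<le> M \<and>
    (\<forall>(\<Omega> :: (real ^ 'n) set) (K :: (real ^ 'n) set).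
       open \<Omega> \<longrightarrow> closedin (top_of_set \<Omega>) K \<longrightarrow>
       (\<forall>x0\<in>K. \<forall>r>0. ball x0 r \<subseteq> \<Omega> \<longrightarrow>
          ennreal (r ^ (CARD('n) - 1) / C0) \<le> hausdorff_measure (CARD('n) - 1) (K \<inter> ball x0 r) \<and>
          hausdorff_measure (CARD('n) - 1) (K \<inter> ball x0 r) \<le> ennreal (C0 * r ^ (CARD('n) - 1))) \<longrightarrow>
       (\<forall>x0\<in>K. \<forall>r>0. ball x0 r \<subseteq> \<Omega> \<longrightarrow>
          (\<exists>V \<in> components (\<Omega> - K). \<exists>W \<in> components (\<Omega> - K).
             V \<noteq> W \<and> V \<inter> ball x0 r \<noteq> {} \<and> W \<inter> ball x0 r \<noteq> {})) \<longrightarrow>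
       (\<forall>x0\<in>K. \<forall>r>0. ball x0 (2 * r) \<subseteq> \<Omega> \<longrightarrow>
          (\<forall>V \<in> components (\<Omega> - K).
             john_domain C0 ((V \<inter> ball x0 (2 * r)) \<union> (ball x0 (2 * r) - cball x0 r)))) \<longrightarrow>
       (\<forall>x0\<in>K. \<forall>r>0. ball x0 (2 * r) \<subseteq> \<Omega> \<longrightarrow>
          (\<forall>F. topological_competitor \<Omega> K x0 r F \<longrightarrow>
             hausdorff_measure (CARD('n) - 1) (K - F)
               \<le> ennreal M * hausdorff_measure (CARD('n) - 1) (F - K))))"
proof -
  define d where "d = CARD('n) - 1"
  define \<theta> where "\<theta> = thin_const CARD('n)"
  \<comment> \<open>the thick ball belonging to \<open>x\<close>, of radius \<open>\<rho> x\<close>, is contained in \<open>cball x (A * \<rho> x)\<close>\<close>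
  define A where "A = 32 * C0\<^sup>2 + 2"
  \<comment> \<open>6 exceeds the factor 5 of Vitali's lemma, since the bounds on \<open>K\<close> are for open balls\<close>
  define M where "M = max 1 (C0 * (6 * A) ^ d / \<theta>)"
  have \<theta>: "0 < \<theta>" by (simp add: \<theta>_def thin_const_pos)
  have A: "0 < A" by (simp add: A_def add_nonneg_pos)
  have bound: "hausdorff_measure d (K - F) \<le> ennreal M * hausdorff_measure d (F - K)"
    if op: "open \<Omega>" and K: "closedin (top_of_set \<Omega>) K"
      and regular: "\<And>x r. x \<in> K \<Longrightarrow> 0 < r \<Longrightarrow> ball x r \<subseteq> \<Omega> \<Longrightarrow>
        hausdorff_measure d (K \<inter> ball x r) \<le> ennreal (C0 * r ^ d)"
      and two: "\<And>x r. x \<in> K \<Longrightarrow> 0 < r \<Longrightarrow> ball x r \<subseteq> \<Omega> \<Longrightarrow>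
        \<exists>V \<in> components (\<Omega> - K). \<exists>W \<in> components (\<Omega> - K).
          V \<noteq> W \<and> V \<inter> ball x r \<noteq> {} \<and> W \<inter> ball x r \<noteq> {}"
      and john: "\<And>V. V \<in> components (\<Omega> - K) \<Longrightarrow>
        john_domain C0 ((V \<inter> ball x0 (2 * r)) \<union> (ball x0 (2 * r) - cball x0 r))"
      and x0: "x0 \<in> K" and r: "0 < r" "ball x0 (2 * r) \<subseteq> \<Omega>"
      and comp: "topological_competitor \<Omega> K x0 r F"
    for \<Omega> K F :: "(real ^ 'n) set" and x0 r
  proof -
    have inside: "K - F \<subseteq> ball x0 r" using comp by (auto simp: topological_competitor_def)
    have "\<exists>\<rho>. 0 < \<rho> \<and> \<rho> \<le> 2 * r \<and>
        ennreal (\<theta> * \<rho> ^ d) \<le> hausdorff_measure d ((F - K) \<inter> cball x (A * \<rho>))" if x: "x \<in> K - F" for x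
    proof -
      have "\<exists>c \<rho>. 0 < \<rho> \<and> \<rho> \<le> 2 * r \<and> dist x c \<le> (32 * C0\<^sup>2 + 1) * \<rho> \<and>
          ennreal (\<theta> * \<rho> ^ d) \<le> hausdorff_measure d ((F - K) \<inter> ball c \<rho>)"
        using thick_ball_near_removed_point[OF _ op K r _ john comp x] two[of x] x assms(1)
        by (simp add: \<theta>_def d_def)
      then obtain c \<rho> where \<rho>: "0 < \<rho>" "\<rho> \<le> 2 * r" "dist x c \<le> (32 * C0\<^sup>2 + 1) * \<rho>"
        and thick: "ennreal (\<theta> * \<rho> ^ d) \<le> hausdorff_measure d ((F - K) \<inter> ball c \<rho>)" by blast
      have "ball c \<rho> \<subseteq> cball x (A * \<rho>)"
      proof
        fix y assume "y \<in> ball c \<rho>"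
        then have "dist x y \<le> (32 * C0\<^sup>2 + 1) * \<rho> + \<rho>"
          using \<rho>(3) dist_triangle[of x y c] by simp
        then show "y \<in> cball x (A * \<rho>)" by (simp add: A_def algebra_simps)
      qed
      then have "hausdorff_measure d ((F - K) \<inter> ball c \<rho>) \<le> hausdorff_measure d ((F - K) \<inter> cball x (A * \<rho>))"
        by (intro hausdorff_measure_mono) auto
      with thick \<rho> show ?thesis using order_trans by blast
    qed
    then obtain \<rho> where \<rho>: "\<And>x. x \<in> K - F \<Longrightarrow> 0 < \<rho> x" "\<And>x. x \<in> K - F \<Longrightarrow> \<rho> x \<le> 2 * r"
      and thick: "\<And>x. x \<in> K - F \<Longrightarrow>
        ennreal (\<theta> * \<rho> x ^ d) \<le> hausdorff_measure d ((F - K) \<inter> cball x (A * \<rho> x))"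
      by metis
    define R where "R = (\<lambda>x. A * \<rho> x)"
    have R: "0 < R x \<and> R x \<le> A * (2 * r)" if "x \<in> K - F" for x
      using \<rho>[OF that] A by (simp add: R_def)
    have "K - F \<subseteq> (\<Union>x\<in>K - F. cball x (R x))" using R by force
    from Vitali_covering_lemma_cballs[where a = "\<lambda>x. x" and r = R, OF this R]
    obtain I where I: "countable I" "I \<subseteq> K - F"
      "pairwise (\<lambda>i j. disjnt (cball i (R i)) (cball j (R j))) I"
      "K - F \<subseteq> (\<Union>i\<in>I. cball i (5 * R i))" by blast
    have local: "hausdorff_measure d ((K - F) \<inter> cball x (5 * R x))
        \<le> ennreal M * hausdorff_measure d ((F - K) \<inter> cball x (R x))" if x: "x \<in> K - F" for x
    proof -
      have Rx: "0 < R x" using R[OF x] by simp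
      have "hausdorff_measure d ((K - F) \<inter> cball x (5 * R x)) \<le> ennreal (C0 * (6 * R x) ^ d)"
      proof (cases "ball x (6 * R x) \<subseteq> \<Omega>")
        case True
        have "hausdorff_measure d ((K - F) \<inter> cball x (5 * R x)) \<le> hausdorff_measure d (K \<inter> ball x (6 * R x))"
          using Rx by (intro hausdorff_measure_mono) auto
        also have "\<dots> \<le> ennreal (C0 * (6 * R x) ^ d)" using x Rx True by (intro regular) auto
        finally show ?thesis .
      next
        \<comment> \<open>the enlarged ball leaves \<open>\<Omega>\<close> only if its radius exceeds \<open>r\<close>, and then \<open>ball x0 r\<close> serves as well\<close>
        case False
        have "ball x r \<subseteq> \<Omega>"
        proof -
          have "dist x0 x < r" using x inside by auto
          then have "ball x r \<subseteq> ball x0 (2 * r)"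
            using r(1) by (simp add: ball_subset_ball_iff dist_commute)
          with r(2) show ?thesis by blast
        qed
        with False have "r \<le> 6 * R x" by (meson linear order_trans subset_ball)
        have "hausdorff_measure d ((K - F) \<inter> cball x (5 * R x)) \<le> hausdorff_measure d (K \<inter> ball x0 r)"
          using inside by (intro hausdorff_measure_mono) auto
        also have "\<dots> \<le> ennreal (C0 * r ^ d)"
        proof (rule regular[OF x0 r(1)])
          have "ball x0 r \<subseteq> ball x0 (2 * r)" using r(1) by auto
          with r(2) show "ball x0 r \<subseteq> \<Omega>" by blast
        qed
        also have "\<dots> \<le> ennreal (C0 * (6 * R x) ^ d)"
          using \<open>r \<le> 6 * R x\<close> r(1) assms(2) by (intro ennreal_leI mult_left_mono power_mono) auto
        finally show ?thesis .
      qed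
      also have "C0 * (6 * R x) ^ d = C0 * (6 * A) ^ d / \<theta> * (\<theta> * \<rho> x ^ d)"
        using \<theta> by (simp add: R_def power_mult_distrib)
      also have "ennreal \<dots> \<le> ennreal (M * (\<theta> * \<rho> x ^ d))"
        using \<theta> \<rho>(1)[OF x] by (intro ennreal_leI mult_right_mono) (auto simp: M_def)
      also have "\<dots> = ennreal M * ennreal (\<theta> * \<rho> x ^ d)"
        using \<theta> \<rho>(1)[OF x] by (intro ennreal_mult) (auto simp: M_def)
      also have "\<dots> \<le> ennreal M * hausdorff_measure d ((F - K) \<inter> cball x (R x))"
        using thick[OF x] by (intro mult_left_mono) (auto simp: R_def)
      finally show ?thesis .
    qed
    show ?thesis
    proof (rule hausdorff_measure_le_if_finite_sums_le[OF I(1,4)])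
      fix J assume J: "finite J" "J \<subseteq> I"
      have "(\<Sum>x\<in>J. hausdorff_measure d ((K - F) \<inter> cball x (5 * R x)))
          \<le> (\<Sum>x\<in>J. ennreal M * hausdorff_measure d ((F - K) \<inter> cball x (R x)))"
        using J(2) I(2) by (intro sum_mono local) auto
      also have "\<dots> = ennreal M * (\<Sum>x\<in>J. hausdorff_measure d ((F - K) \<inter> cball x (R x)))"
        by (simp add: sum_distrib_left)
      also have "\<dots> \<le> ennreal M * hausdorff_measure d ((F - K) \<inter> (\<Union>x\<in>J. cball x (R x)))"
        using J pairwise_subset[OF I(3) J(2)]
        by (intro mult_left_mono sum_hausdorff_measure_disjoint_compacts_le) auto
      also have "\<dots> \<le> ennreal M * hausdorff_measure d (F - K)"
        by (intro mult_left_mono hausdorff_measure_mono) auto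
      finally show "(\<Sum>x\<in>J. hausdorff_measure d ((K - F) \<inter> cball x (5 * R x)))
          \<le> ennreal M * hausdorff_measure d (F - K)" .
    qed
  qed
  have "1 \<le> M" by (simp add: M_def)
  then show ?thesis
    by (intro exI[of _ M] conjI allI impI ballI) (assumption | rule bound[unfolded d_def]; blast)+
qed

end
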